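(* Consider the Polyhedral Clinching Auction run on the modified market as described in the context, with all participants reporting truthfully. Then $${\rm SW}^{\rm PCA}=\sum_{i\in N}v_ix^{\rm f}_i\ \ge\ \sum_{i\in N}v_ix^*_i={\rm LW}^{\rm OPT}.$$
   Context: Market model. Buyers $N_0=\{1,\dots,n\}$, sellers $M=\{1,\dots,m\}$, bipartite edge set $E_0\subseteq N_0\times M$; edge $(i,j)$ written $ij$; for a set $S$ of participants $E_S$ is the set of edges incident to a member of $S$ ($E_i=E_{\{i\}}$); $w(F)=\sum_{e\in F}w_e$. Each seller $j$ has a monotone submodular $f_j:2^{E_j}\to\mathbb R_+$, $f_j(\emptyset)=0$ ($f_j(E_j)$ = her total amount of a homogeneous divisible good). Buyer $i$ has per-unit valuation $v_i>0$ and budget $B_i\ge0$; seller $j$ has per-unit valuation $\rho_j>0$. Modified market. For each seller $j$ add a virtual buyer $n+j$ adjacent only to $j$ with $v_{n+j}=\rho_j$, $B_{n+j}=\infty$; $N=\{1,\dots,n+m\}$, $E=E_0\cup\{(n+j)j\}$; extend $f_j$ by $f_j(F)=f_j(E_j)$ if $(n+j)j\in F$, unchanged otherwise; $P_j=\{y\in\mathbb R^{E_j}_+:y(F)\le f_j(F)\ \forall F\}$, $P=\{w\in\mathbb R^E_+:w|_{E_j}\in P_j\ \forall j\}$, $f(S)=\sum_jf_j(S\cap E_j)$. The amount $w_{(n+j)j}$ represents goods seller $j$ keeps, so social welfare is $\sum_{i\in N}v_iw(E_i)$ and liquid welfare $\sum_{i\in N}\min(v_iw(E_i),B_i)$. For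 $i\in N$, $H_i$ is the set of buyers $k$ with $v_k>v_i$, or $v_k=v_i$ and $k<i$; $x^*\in\mathbb R^N_+$ is defined recursively (decreasing valuation, ties by index) by $x^*_i=\min(B_i/v_i,\min_{H\subseteq H_i}\{f(E_{H\cup\{i\}})-x^*(H)\})$; ${\rm LW}^{\rm OPT}=\max_{w\in P}\sum_{i\in N}\min(v_iw(E_i),B_i)$. Polyhedral Clinching Auction (PCA) with step $\varepsilon>0$: bids $v'_i$ for $i\in N$ (virtual buyer $n+j$ bids seller $j$'s bid), all assumed to be positive integer multiples of $\varepsilon$. State: $w\in\mathbb R^E_+$, payments $p$, revenues $r$, price clocks $c_i$, demands $d_i\in[0,\infty]$; initially $w=0,p=0,r=0$, $c_i=0$, $d_i=\infty$, pointer $l=1$. For $w,d$ let $P_{w,d}=\{y\in\mathbb R^E_+: w+y\in P,\ y(E_k)\le d_k\ \forall k\}$ and for $\xi\in\mathbb R^{E_i}_+$ let $P^i_{w,d}(\xi)=\{u\in\mathbb R^{N\setminus\{i\}}_+:\exists y\in P_{w,d},\ y|_{E_i}=\xi,\ y(E_k)=u_k\ \forall k\ne i\}$. While some $d_i\neq 0$, an iteration does: (1) clinching step: for $i=1,\dots,n+m$ in turn, choose a maximal $\xi_i\in\mathbb R^{E_i}_+$ with $P^i_{w,d}(\xi_i)=P^i_{w,d}(0)$, set $p_i\leftarrow p_i+c_i\xi_i(E_i)$, $w_{ij}\leftarrow w_{ij}+\xi_{ij}$, and reset every demand to $d_k=(B_k-p_k)/c_k$ if $c_k<v'_k$ and $d_k=0$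 otherwise ($d_k=\infty$ while $c_k=0$); then $r_j\leftarrow r_j+\sum_{ij\in E_j}c_i\xi_{ij}$; (2) $c_l\leftarrow c_l+\varepsilon$ and $d_l\leftarrow(B_l-p_l)/c_l$ if $c_l<v'_l$, else $d_l\leftarrow0$; (3) advance $l$ cyclically. For $i\in N$, $x^{\rm f}_i$ denotes the value of $w(E_i)$ at termination, and ${\rm SW}^{\rm PCA}=\sum_{i\in N}v_ix^{\rm f}_i$. Truthful reporting means $v'_i=v_i$ for all $i\in N$. *)

theory Defs
  imports Complex_Main "HOL-Library.Extended_Real" "HOL-Library.Product_Lexorder"
begin

type_synonym edge = "nat \<times> nat"   (* (buyer, seller) *)

text \<open>The (original) market: buyers 1..nb, sellers 1..ms, edge set E0 (subset of
  buyers x sellers), seller functions fs j on subsets of the seller's edges,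
  buyer valuations val, buyer budgets bud, seller valuations rho.\<close>
record market =
  nb  :: nat
  ms  :: nat
  E0  :: "edge set"
  fs  :: "nat \<Rightarrow> edge set \<Rightarrow> real"
  val :: "nat \<Rightarrow> real"
  bud :: "nat \<Rightarrow> real"
  rho :: "nat \<Rightarrow> real"

definition allN :: "market \<Rightarrow> nat set" where
  "allN M = {1..nb M + ms M}"

definition Emod :: "market \<Rightarrow> edge set" where
  "Emod M = E0 M \<union> {(nb M + j, j) | j. j \<in> {1..ms M}}"

definition Ebuy :: "edge set \<Rightarrow> nat \<Rightarrow> edge set" where
  "Ebuy E i = {e \<in> E. fst e = i}"

definition Ebuys :: "edge set \<Rightarrow> nat set \<Rightarrow> edge set" where
  "Ebuys E S = {e \<in> E. fst e \<in> S}"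

definition Esel :: "edge set \<Rightarrow> nat \<Rightarrow> edge set" where
  "Esel E j = {e \<in> E. snd e = j}"

text \<open>valuations and budgets in the modified market (virtual buyer nb+j has
  valuation rho j and infinite budget)\<close>
definition vm :: "market \<Rightarrow> nat \<Rightarrow> real" where
  "vm M i = (if i \<le> nb M then val M i else rho M (i - nb M))"

definition Bm :: "market \<Rightarrow> nat \<Rightarrow> ereal" where
  "Bm M i = (if i \<le> nb M then ereal (bud M i) else \<infinity>)"

definition fext :: "market \<Rightarrow> nat \<Rightarrow> edge set \<Rightarrow> real" where
  "fext M j F = (if (nb M + j, j) \<in> F then fs M j (Esel (E0 M) j) else fs M j F)"

definition fN :: "market \<Rightarrow> edge set \<Rightarrow> real" where
  "fN M S = (\<Sum>j\<in>{1..ms M}. fext M j (S \<inter> Esel (Emod M) j))"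

text \<open>vectors in R^E_+ (functions supported on E, nonnegative there)\<close>
definition nonneg_on :: "edge set \<Rightarrow> (edge \<Rightarrow> real) \<Rightarrow> bool" where
  "nonneg_on E w \<longleftrightarrow> (\<forall>e\<in>E. 0 \<le> w e) \<and> (\<forall>e. e \<notin> E \<longrightarrow> w e = 0)"

definition inP :: "market \<Rightarrow> (edge \<Rightarrow> real) \<Rightarrow> bool" where
  "inP M w \<longleftrightarrow> nonneg_on (Emod M) w \<and>
     (\<forall>j\<in>{1..ms M}. \<forall>F. F \<subseteq> Esel (Emod M) j \<longrightarrow> sum w F \<le> fext M j F)"

definition LW :: "market \<Rightarrow> (edge \<Rightarrow> real) \<Rightarrow> ereal" where
  "LW M w = (\<Sum>i\<in>allN M. min (ereal (vm M i * sum w (Ebuy (Emod M) i))) (Bm M i))"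

definition LW_OPT :: "market \<Rightarrow> ereal" where
  "LW_OPT M = Sup (LW M ` {w. inP M w})"

definition Hset :: "market \<Rightarrow> nat \<Rightarrow> nat set" where
  "Hset M i = {k \<in> allN M. vm M k > vm M i \<or> (vm M k = vm M i \<and> k < i)}"

definition order_list :: "market \<Rightarrow> nat list" where
  "order_list M = sort_key (\<lambda>i. (- vm M i, i)) [1..<nb M + ms M + 1]"

definition xstar_step :: "market \<Rightarrow> (nat \<Rightarrow> real) \<Rightarrow> nat \<Rightarrow> (nat \<Rightarrow> real)" where
  "xstar_step M x i = x(i := real_of_ereal
     (min (Bm M i / ereal (vm M i))
          (ereal (Min {fN M (Ebuys (Emod M) (H \<union> {i})) - sum x H | H. H \<subseteq> Hset M i}))))"

definition xstar :: "market \<Rightarrow> nat \<Rightarrow> real" where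
  "xstar M = foldl (xstar_step M) (\<lambda>_. 0) (order_list M)"

record pca_state =
  wS :: "edge \<Rightarrow> real"
  pS :: "nat \<Rightarrow> real"
  cS :: "nat \<Rightarrow> real"
  dS :: "nat \<Rightarrow> ereal"
  lS :: nat

text \<open>demand of k given price clocks c, payments p and bids b\<close>
definition dem :: "market \<Rightarrow> (nat \<Rightarrow> real) \<Rightarrow> (nat \<Rightarrow> real) \<Rightarrow> (nat \<Rightarrow> real) \<Rightarrow> nat \<Rightarrow> ereal" where
  "dem M b c p k = (if c k = 0 then \<infinity>
                    else if c k < b k then (Bm M k - ereal (p k)) / ereal (c k) else 0)"

definition Pwd :: "market \<Rightarrow> (edge \<Rightarrow> real) \<Rightarrow> (nat \<Rightarrow> ereal) \<Rightarrow> (edge \<Rightarrow> real) set" where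
  "Pwd M w d = {y. nonneg_on (Emod M) y \<and> inP M (\<lambda>e. w e + y e) \<and>
                   (\<forall>k\<in>allN M. ereal (sum y (Ebuy (Emod M) k)) \<le> d k)}"

text \<open>P^i_{w,d}(xi); vectors in R^{N minus i} represented as functions vanishing outside N minus i\<close>
definition Pproj :: "market \<Rightarrow> (edge \<Rightarrow> real) \<Rightarrow> (nat \<Rightarrow> ereal) \<Rightarrow> nat \<Rightarrow> (edge \<Rightarrow> real) \<Rightarrow> (nat \<Rightarrow> real) set" where
  "Pproj M w d i xi = {u. \<exists>y\<in>Pwd M w d. (\<forall>e\<in>Ebuy (Emod M) i. y e = xi e) \<and>
      u = (\<lambda>k. if k \<in> allN M - {i} then sum y (Ebuy (Emod M) k) else 0)}"

definition clinchable :: "market \<Rightarrow> (edge \<Rightarrow> real) \<Rightarrow> (nat \<Rightarrow> ereal) \<Rightarrow> nat \<Rightarrow> (edge \<Rightarrow> real) \<Rightarrow> bool" where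
  "clinchable M w d i xi \<longleftrightarrow> nonneg_on (Ebuy (Emod M) i) xi \<and>
      Pproj M w d i xi = Pproj M w d i (\<lambda>_. 0)"

definition max_clinchable :: "market \<Rightarrow> (edge \<Rightarrow> real) \<Rightarrow> (nat \<Rightarrow> ereal) \<Rightarrow> nat \<Rightarrow> (edge \<Rightarrow> real) \<Rightarrow> bool" where
  "max_clinchable M w d i xi \<longleftrightarrow> clinchable M w d i xi \<and>
      \<not> (\<exists>xi'. clinchable M w d i xi' \<and> (\<forall>e. xi e \<le> xi' e) \<and> xi' \<noteq> xi)"

definition clinch_one :: "market \<Rightarrow> (nat \<Rightarrow> real) \<Rightarrow> nat \<Rightarrow> pca_state \<Rightarrow> pca_state \<Rightarrow> bool" where
  "clinch_one M b i s s' \<longleftrightarrow> (\<exists>xi. max_clinchable M (wS s) (dS s) i xi \<and>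
     (let p' = (pS s)(i := pS s i + cS s i * sum xi (Ebuy (Emod M) i)) in
      s' = s\<lparr> wS := (\<lambda>e. wS s e + xi e), pS := p', dS := dem M b (cS s) p' \<rparr>))"

inductive clinch_list :: "market \<Rightarrow> (nat \<Rightarrow> real) \<Rightarrow> nat list \<Rightarrow> pca_state \<Rightarrow> pca_state \<Rightarrow> bool"
  for M b where
  Nil: "clinch_list M b [] s s"
| Cons: "clinch_one M b i s s1 \<Longrightarrow> clinch_list M b is s1 s2 \<Longrightarrow> clinch_list M b (i # is) s s2"

definition pca_init :: pca_state where
  "pca_init = \<lparr> wS = (\<lambda>_. 0), pS = (\<lambda>_. 0), cS = (\<lambda>_. 0), dS = (\<lambda>_. \<infinity>), lS = 1 \<rparr>"

definition pca_iter :: "market \<Rightarrow> real \<Rightarrow> (nat \<Rightarrow> real) \<Rightarrow> pca_state \<Rightarrow> pca_state \<Rightarrow> bool" where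
  "pca_iter M eps b s s' \<longleftrightarrow> (\<exists>i\<in>allN M. dS s i \<noteq> 0) \<and>
     (\<exists>s1. clinch_list M b [1..<nb M + ms M + 1] s s1 \<and>
        (let l = lS s1; c' = (cS s1)(l := cS s1 l + eps) in
         s' = s1\<lparr> cS := c', dS := (dS s1)(l := dem M b c' (pS s1) l),
                  lS := l mod (nb M + ms M) + 1 \<rparr>))"

definition pca_final :: "market \<Rightarrow> real \<Rightarrow> (nat \<Rightarrow> real) \<Rightarrow> pca_state \<Rightarrow> bool" where
  "pca_final M eps b s \<longleftrightarrow> (pca_iter M eps b)\<^sup>*\<^sup>* pca_init s \<and> (\<forall>i\<in>allN M. dS s i = 0)"

end

theory Submission
  imports Defs
begin

text \<open>
  Let \<open>r(S)\<close> be the largest amount that the buyers in \<open>S\<close> can still obtain from a residual supply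
  \<open>g\<close> under demands \<open>d\<close>. By duality \<open>r(S)\<close> is the minimum of \<open>g(F) + d(S - H)\<close> over
  \<open>H \<subseteq> S\<close> and edge sets \<open>F\<close> containing the edges of \<open>H\<close>; it is submodular, and the amounts that
  the buyers can obtain form its polymatroid. For \<open>d = B / v\<close> the greedy base of this polymatroid is
  \<open>x\<^sup>*\<close>. So \<open>x\<^sup>*\<close> attains \<open>r\<close> on every level set of the valuations, and summation by parts
  shows that it has maximal welfare.

  A vector \<open>\<xi>\<close> can be clinched by \<open>i\<close> iff \<open>\<xi>(E\<^sub>i) \<le> d\<^sub>i\<close> and \<open>r(T) + \<xi>(F) \<le> g(F)\<close> whenever
  \<open>F\<close> contains the edges of \<open>T \<subseteq> N - {i}\<close>. Hence clinching does not lower the potential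
  \<open>w(E\<^sub>S) + r(S)\<close>, and after a maximal clinching \<open>r(N) = r(N - {i})\<close>, so the next price increase
  for \<open>i\<close> loses no goods. A price increase for an active buyer \<open>l \<in> S\<close> leaves the potential of
  \<open>S\<close> above its old value or above the old potential of \<open>S - {l}\<close> plus \<open>B\<^sub>l / v\<^sub>l\<close>, because \<open>l\<close> pays
  at most \<open>v\<^sub>l\<close> per unit. Therefore the potential of every set of active buyers dominates every
  budget-feasible vector, and once the buyers below a valuation level have dropped out, those above
  it receive all that remains. The final allocation thus dominates \<open>x\<^sup>*\<close> on every level set, and
  summation by parts gives the inequality.
\<close>

section \<open>Finite sums and finite sets of reals\<close>

lemma sum_fun_upd_add:
  fixes y :: "'a \<Rightarrow> real"
  assumes "finite F"
  shows "sum (y(e := y e + a)) F = sum y F + (if e \<in> F then a else 0)"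
proof -
  have "sum (y(e := y e + a)) F = (\<Sum>x\<in>F. y x + (if x = e then a else 0))"
    by (rule sum.cong) auto
  then show ?thesis
    using assms by (simp add: sum.distrib)
qed

lemma sum_mult_mono_level_sets:
  fixes v a b :: "'a \<Rightarrow> real"
  assumes "finite N" "\<And>i. i \<in> N \<Longrightarrow> 0 \<le> v i"
    and "\<And>\<theta>. \<theta> \<in> v ` N \<Longrightarrow> sum a {i \<in> N. \<theta> \<le> v i} \<le> sum b {i \<in> N. \<theta> \<le> v i}"
  shows "(\<Sum>i\<in>N. v i * a i) \<le> (\<Sum>i\<in>N. v i * b i)"
  using assms
proof (induction N arbitrary: v rule: finite_psubset_induct)
  case (psubset N)
  show ?case
  proof (cases "N = {}")
    case False
    define m where "m = Min (v ` N)"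
    have m_in: "m \<in> v ` N"
      unfolding m_def using False psubset.hyps by (intro Min_in) auto
    have m_le: "m \<le> v i" if "i \<in> N" for i
      using that psubset.hyps by (simp add: m_def)
    define N' where "N' = {i \<in> N. m < v i}"
    have peel: "(\<Sum>i\<in>N. v i * c i) = m * sum c N + (\<Sum>i\<in>N'. (v i - m) * c i)" for c
    proof -
      have "(\<Sum>i\<in>N'. (v i - m) * c i) = (\<Sum>i\<in>N. (v i - m) * c i)"
        using psubset.hyps m_le by (intro sum.mono_neutral_left) (force simp: N'_def)+
      then show ?thesis
        by (simp add: left_diff_distrib sum_subtractf sum_distrib_left)
    qed
    have "(\<Sum>i\<in>N'. (v i - m) * a i) \<le> (\<Sum>i\<in>N'. (v i - m) * b i)"
    proof (rule psubset.IH)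
      show "N' \<subset> N" using m_in by (auto simp: N'_def)
      fix \<theta> assume "\<theta> \<in> (\<lambda>i. v i - m) ` N'"
      then obtain k where k: "k \<in> N'" "\<theta> = v k - m" by blast
      then have "{i \<in> N'. \<theta> \<le> v i - m} = {i \<in> N. v k \<le> v i}"
        by (auto simp: N'_def)
      then show "sum a {i \<in> N'. \<theta> \<le> v i - m} \<le> sum b {i \<in> N'. \<theta> \<le> v i - m}"
        using psubset.prems(2)[of "v k"] k by (auto simp: N'_def)
    qed (auto simp: N'_def)
    moreover have "{i \<in> N. m \<le> v i} = N" using m_le by auto
    then have "m * sum a N \<le> m * sum b N"
      using psubset.prems(1) psubset.prems(2)[OF m_in] m_in by (auto intro: mult_left_mono)
    ultimately show ?thesis
      by (simp add: peel)
  qed simp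
qed

lemma finite_between:
  fixes A B :: "'a::linorder set"
  assumes "finite A" "A \<noteq> {}" "\<And>a b. a \<in> A \<Longrightarrow> b \<in> B \<Longrightarrow> a \<le> b"
  obtains c where "\<And>a. a \<in> A \<Longrightarrow> a \<le> c" "\<And>b. b \<in> B \<Longrightarrow> c \<le> b"
proof (rule that)
  show "a \<le> Max A" if "a \<in> A" for a
    using assms(1) that by (rule Max_ge)
  show "Max A \<le> b" if "b \<in> B" for b
    using Max_in[OF assms(1,2)] that by (rule assms(3))
qed

lemma finite_positive_lower_bound:
  fixes A :: "real set"
  assumes "finite A" "\<And>a. a \<in> A \<Longrightarrow> 0 < a"
  obtains \<delta> where "0 < \<delta>" "\<And>a. a \<in> A \<Longrightarrow> \<delta> \<le> a"
proof (rule that)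
  show "0 < Min (insert 1 A)" "a \<in> A \<Longrightarrow> Min (insert 1 A) \<le> a" for a
    using assms by auto
qed

section \<open>Polymatroids\<close>

definition submodular_on :: "'a set \<Rightarrow> ('a set \<Rightarrow> real) \<Rightarrow> bool" where
  "submodular_on E g \<longleftrightarrow> (\<forall>F\<subseteq>E. \<forall>G\<subseteq>E. g (F \<union> G) + g (F \<inter> G) \<le> g F + g G)"

lemma submodular_onI:
  "(\<And>F G. F \<subseteq> E \<Longrightarrow> G \<subseteq> E \<Longrightarrow> g (F \<union> G) + g (F \<inter> G) \<le> g F + g G) \<Longrightarrow> submodular_on E g"
  by (simp add: submodular_on_def)

lemma submodular_onD:
  "submodular_on E g \<Longrightarrow> F \<subseteq> E \<Longrightarrow> G \<subseteq> E \<Longrightarrow> g (F \<union> G) + g (F \<inter> G) \<le> g F + g G"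
  by (simp add: submodular_on_def)

lemma submodular_on_subset: "submodular_on E g \<Longrightarrow> A \<subseteq> E \<Longrightarrow> submodular_on A g"
  by (auto simp: submodular_on_def)

lemma submodular_on_diff_sum:
  assumes "finite E" "submodular_on E g"
  shows "submodular_on E (\<lambda>F. g F - sum w F)"
proof (rule submodular_onI)
  fix F G assume FG: "F \<subseteq> E" "G \<subseteq> E"
  then have "sum w (F \<union> G) + sum w (F \<inter> G) = sum w F + sum w G"
    using assms(1) by (intro sum.union_inter) (auto intro: finite_subset)
  then show "g (F \<union> G) - sum w (F \<union> G) + (g (F \<inter> G) - sum w (F \<inter> G))
      \<le> g F - sum w F + (g G - sum w G)"
    using submodular_onD[OF assms(2) FG] by linarith
qed

definition polymatroid :: "'a set \<Rightarrow> ('a set \<Rightarrow> real) \<Rightarrow> ('a \<Rightarrow> real) set" where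
  "polymatroid E g = {y. (\<forall>e. 0 \<le> y e) \<and> (\<forall>e. e \<notin> E \<longrightarrow> y e = 0) \<and> (\<forall>F\<subseteq>E. sum y F \<le> g F)}"

lemma polymatroidI:
  "(\<And>e. 0 \<le> y e) \<Longrightarrow> (\<And>e. e \<notin> E \<Longrightarrow> y e = 0) \<Longrightarrow> (\<And>F. F \<subseteq> E \<Longrightarrow> sum y F \<le> g F) \<Longrightarrow>
    y \<in> polymatroid E g"
  by (simp add: polymatroid_def)

lemma polymatroid_nonneg: "y \<in> polymatroid E g \<Longrightarrow> 0 \<le> y e"
  and polymatroid_outside: "y \<in> polymatroid E g \<Longrightarrow> e \<notin> E \<Longrightarrow> y e = 0"
  and polymatroid_sum_le: "y \<in> polymatroid E g \<Longrightarrow> F \<subseteq> E \<Longrightarrow> sum y F \<le> g F"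
  by (auto simp: polymatroid_def)

lemma polymatroid_extend:
  assumes "finite N" "S \<subseteq> N" "mono_on (Pow N) h" "u \<in> polymatroid S h"
  shows "u \<in> polymatroid N h"
proof (rule polymatroidI)
  fix T assume T: "T \<subseteq> N"
  have "sum u T = sum u (T \<inter> S)"
    using T assms(1) polymatroid_outside[OF assms(4)]
    by (intro sum.mono_neutral_right) (auto intro: finite_subset)
  also have "\<dots> \<le> h (T \<inter> S)"
    by (rule polymatroid_sum_le[OF assms(4)]) simp
  also have "\<dots> \<le> h T"
    using T by (intro mono_onD[OF assms(3)]) auto
  finally show "sum u T \<le> h T" .
qed (use assms(2) polymatroid_nonneg[OF assms(4)] polymatroid_outside[OF assms(4)] in auto)

lemma polymatroid_restrict:
  assumes "u \<in> polymatroid N h" "S \<subseteq> N"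
  shows "(\<lambda>k. if k \<in> S then u k else 0) \<in> polymatroid S h"
proof (rule polymatroidI)
  fix T assume T: "T \<subseteq> S"
  then have "(\<Sum>k\<in>T. if k \<in> S then u k else 0) = sum u T"
    by (intro sum.cong) auto
  then show "(\<Sum>k\<in>T. if k \<in> S then u k else 0) \<le> h T"
    using polymatroid_sum_le[OF assms(1), of T] T assms(2) by simp
qed (use polymatroid_nonneg[OF assms(1)] in auto)

lemma polymatroid_insert:
  assumes "finite S" "k \<notin> S" "u \<in> polymatroid S h" "0 \<le> t"
    and t_le: "\<And>T. T \<subseteq> S \<Longrightarrow> t + sum u T \<le> h (insert k T)"
  shows "u(k := t) \<in> polymatroid (insert k S) h"
proof (rule polymatroidI)
  fix T assume T: "T \<subseteq> insert k S"
  have "u(k := t) = u(k := u k + t)"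
    using polymatroid_outside[OF assms(3,2)] by simp
  moreover have "finite T" using T assms(1) by (auto intro: finite_subset)
  ultimately have sum: "sum (u(k := t)) T = sum u T + (if k \<in> T then t else 0)"
    by (simp only: sum_fun_upd_add)
  show "sum (u(k := t)) T \<le> h T"
  proof (cases "k \<in> T")
    case True
    then have "sum u T = sum u (T - {k})"
      using \<open>finite T\<close> polymatroid_outside[OF assms(3,2)] by (simp add: sum.remove)
    then show ?thesis
      using sum t_le[of "T - {k}"] T True by (simp add: insert_absorb subset_insert_iff)
  next
    case False
    then show ?thesis
      using sum polymatroid_sum_le[OF assms(3), of T] T by (simp add: subset_insert)
  qed
qed (use assms(4) polymatroid_nonneg[OF assms(3)] polymatroid_outside[OF assms(3)] in auto)

lemma polymatroid_base_insert:
  assumes "finite S" "k \<notin> S" "submodular_on (insert k S) h" "mono_on (Pow (insert k S)) h"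
    and u: "u \<in> polymatroid S h" "sum u S = h S"
  defines "t \<equiv> h (insert k S) - h S"
  shows "u(k := t) \<in> polymatroid (insert k S) h" "sum (u(k := t)) (insert k S) = h (insert k S)"
proof -
  have "0 \<le> t"
    unfolding t_def using mono_onD[OF assms(4), of S "insert k S"] by auto
  moreover have "t + sum u T \<le> h (insert k T)" if "T \<subseteq> S" for T
  proof -
    have "h (insert k T \<union> S) + h (insert k T \<inter> S) \<le> h (insert k T) + h S"
      using that by (intro submodular_onD[OF assms(3)]) auto
    moreover have "insert k T \<union> S = insert k S" "insert k T \<inter> S = T"
      using that assms(2) by auto
    ultimately show ?thesis
      using polymatroid_sum_le[OF u(1) that] by (simp add: t_def)
  qed
  ultimately show "u(k := t) \<in> polymatroid (insert k S) h"
    using assms(1,2) u(1) by (intro polymatroid_insert)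
  have "sum (u(k := t)) S = sum u S"
    using assms(2) by (intro sum.cong) auto
  then show "sum (u(k := t)) (insert k S) = h (insert k S)"
    using assms(1,2) u(2) by (simp add: t_def)
qed

lemma polymatroid_base_exists:
  assumes "finite S" "h {} = 0" "submodular_on S h" "mono_on (Pow S) h"
  shows "\<exists>u\<in>polymatroid S h. sum u S = h S"
  using assms
proof (induction S rule: finite_induct)
  case empty
  then show ?case by (intro bexI[of _ "\<lambda>_. 0"]) (auto intro: polymatroidI)
next
  case (insert k S)
  have "submodular_on S h" "mono_on (Pow S) h"
    using insert.prems(2,3) by (blast intro: submodular_on_subset mono_on_subset)+
  then obtain u where u: "u \<in> polymatroid S h" "sum u S = h S"
    using insert.IH insert.prems(1) by blast
  show ?case
    using polymatroid_base_insert[OF insert.hyps insert.prems(2,3) u] by blast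
qed

section \<open>Aggregating a polymatroid\<close>

definition covers :: "('e \<Rightarrow> 'n) \<Rightarrow> 'e set \<Rightarrow> 'e set \<Rightarrow> 'n set \<Rightarrow> bool" where
  "covers own E F T \<longleftrightarrow> F \<subseteq> E \<and> {e \<in> E. own e \<in> T} \<subseteq> F"

definition hall_condition ::
  "('e \<Rightarrow> 'n) \<Rightarrow> 'n set \<Rightarrow> 'e set \<Rightarrow> ('e set \<Rightarrow> real) \<Rightarrow> ('n \<Rightarrow> real) \<Rightarrow> bool" where
  "hall_condition own N E g u \<longleftrightarrow> (\<forall>T\<subseteq>N. \<forall>F. covers own E F T \<longrightarrow> sum u T \<le> g F)"

lemma hall_conditionD:
  "hall_condition own N E g u \<Longrightarrow> T \<subseteq> N \<Longrightarrow> covers own E F T \<Longrightarrow> sum u T \<le> g F"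
  by (simp add: hall_condition_def)

lemma hall_condition_mono:
  assumes "hall_condition own N E g u" "\<And>k. k \<in> N \<Longrightarrow> x k \<le> u k"
  shows "hall_condition own N E g x"
  unfolding hall_condition_def
proof (intro allI impI)
  fix T F assume T: "T \<subseteq> N" "covers own E F T"
  have "sum x T \<le> sum u T"
    using assms(2) T(1) by (intro sum_mono) auto
  also have "\<dots> \<le> g F"
    using assms(1) T by (rule hall_conditionD)
  finally show "sum x T \<le> g F" .
qed

definition fix_value :: "('e set \<Rightarrow> real) \<Rightarrow> 'e \<Rightarrow> real \<Rightarrow> 'e set \<Rightarrow> real" where
  "fix_value g e a F = min (g F) (g (insert e F) - a)"

lemma submodular_on_fix_value:
  assumes "submodular_on (insert e E) g" "e \<notin> E"
  shows "submodular_on E (fix_value g e a)"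
proof (rule submodular_onI)
  fix F G assume FG: "F \<subseteq> E" "G \<subseteq> E"
  then have eqs: "insert e F \<union> insert e G = insert e (F \<union> G)"
    "insert e F \<inter> insert e G = insert e (F \<inter> G)"
    "F \<union> insert e G = insert e (F \<union> G)" "F \<inter> insert e G = F \<inter> G"
    "insert e F \<union> G = insert e (F \<union> G)" "insert e F \<inter> G = F \<inter> G"
    using assms(2) by auto
  have "g (F \<union> G) + g (F \<inter> G) \<le> g F + g G"
    "g (insert e (F \<union> G)) + g (insert e (F \<inter> G)) \<le> g (insert e F) + g (insert e G)"
    "g (insert e (F \<union> G)) + g (F \<inter> G) \<le> g F + g (insert e G)"
    "g (insert e (F \<union> G)) + g (F \<inter> G) \<le> g (insert e F) + g G"
    using submodular_onD[OF assms(1), of F G]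
      submodular_onD[OF assms(1), of "insert e F" "insert e G"]
      submodular_onD[OF assms(1), of F "insert e G"]
      submodular_onD[OF assms(1), of "insert e F" G] FG
    unfolding eqs by blast+
  then show "fix_value g e a (F \<union> G) + fix_value g e a (F \<inter> G)
      \<le> fix_value g e a F + fix_value g e a G"
    unfolding fix_value_def by linarith
qed

lemma polymatroid_fix_value_insert:
  assumes "finite E" "e \<notin> E" "0 \<le> a" "y \<in> polymatroid E (fix_value g e a)"
  shows "y(e := a) \<in> polymatroid (insert e E) g"
proof (rule polymatroid_insert[OF assms(1,2) _ assms(3)])
  show "y \<in> polymatroid E g"
    using assms(4) by (auto simp: polymatroid_def fix_value_def)
  show "a + sum y F \<le> g (insert e F)" if "F \<subseteq> E" for F
    using polymatroid_sum_le[OF assms(4) that] by (simp add: fix_value_def)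
qed

text \<open>The bounds on the value \<open>a\<close> of \<open>e\<close> under which Hall's condition survives the passage to
  \<open>fix_value g e a\<close> and to the demand \<open>u (own e) - a\<close> of the owner of \<open>e\<close>.\<close>

definition fix_lower_bounds ::
  "('e \<Rightarrow> 'n) \<Rightarrow> 'n set \<Rightarrow> 'e set \<Rightarrow> ('e set \<Rightarrow> real) \<Rightarrow> ('n \<Rightarrow> real) \<Rightarrow> 'e \<Rightarrow> real set" where
  "fix_lower_bounds own N E g u e =
     {sum u T - g F | T F. T \<subseteq> N \<and> own e \<in> T \<and> covers own E F T}"

definition fix_upper_bounds ::
  "('e \<Rightarrow> 'n) \<Rightarrow> 'n set \<Rightarrow> 'e set \<Rightarrow> ('e set \<Rightarrow> real) \<Rightarrow> ('n \<Rightarrow> real) \<Rightarrow> 'e \<Rightarrow> real set" where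
  "fix_upper_bounds own N E g u e =
     {g (insert e F) - sum u T | T F. T \<subseteq> N \<and> own e \<notin> T \<and> covers own E F T}"

lemma hall_condition_fix_value:
  assumes "finite N" and hall: "hall_condition own N (insert e E) g u"
    and lower: "\<And>b. b \<in> fix_lower_bounds own N E g u e \<Longrightarrow> b \<le> a"
    and upper: "\<And>b. b \<in> fix_upper_bounds own N E g u e \<Longrightarrow> a \<le> b"
  shows "hall_condition own N E (fix_value g e a) (u(own e := u (own e) - a))"
  unfolding hall_condition_def
proof (intro allI impI)
  fix T F assume T: "T \<subseteq> N" "covers own E F T"
  have "finite T"
    using T(1) assms(1) by (rule finite_subset)
  then have sum: "sum (u(own e := u (own e) - a)) T = sum u T - (if own e \<in> T then a else 0)"
    using sum_fun_upd_add[of T u "own e" "- a"] by simp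
  show "sum (u(own e := u (own e) - a)) T \<le> fix_value g e a F"
  proof (cases "own e \<in> T")
    case True
    have "sum u T \<le> g (insert e F)"
      using T by (intro hall_conditionD[OF hall]) (auto simp: covers_def)
    moreover have "sum u T - g F \<le> a"
      using T True by (intro lower) (auto simp: fix_lower_bounds_def)
    ultimately show ?thesis
      using sum True by (simp add: fix_value_def)
  next
    case False
    have "sum u T \<le> g F"
      using T False by (intro hall_conditionD[OF hall]) (auto simp: covers_def)
    moreover have "a \<le> g (insert e F) - sum u T"
      using T False by (intro upper) (auto simp: fix_upper_bounds_def)
    ultimately show ?thesis
      using sum False by (simp add: fix_value_def)
  qed
qed

lemma fix_lower_bounds_le:
  assumes "finite N" and hall: "hall_condition own N (insert e E) g u"
    and "a \<in> fix_lower_bounds own N E g u e"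
  shows "a \<le> u (own e)"
proof -
  obtain T F where T: "T \<subseteq> N" "own e \<in> T" "covers own E F T" "a = sum u T - g F"
    using assms(3) by (auto simp: fix_lower_bounds_def)
  then have "sum u (T - {own e}) \<le> g F"
    by (intro hall_conditionD[OF hall]) (auto simp: covers_def)
  moreover have "finite T"
    using T(1) assms(1) by (rule finite_subset)
  ultimately show ?thesis
    using T by (simp add: sum_diff1)
qed

lemma fix_upper_bounds_nonneg:
  assumes hall: "hall_condition own N (insert e E) g u" and "b \<in> fix_upper_bounds own N E g u e"
  shows "0 \<le> b"
proof -
  obtain T F where T: "T \<subseteq> N" "own e \<notin> T" "covers own E F T" "b = g (insert e F) - sum u T"
    using assms(2) by (auto simp: fix_upper_bounds_def)
  then have "sum u T \<le> g (insert e F)"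
    by (intro hall_conditionD[OF hall]) (auto simp: covers_def)
  then show ?thesis
    using T by simp
qed

lemma fix_lower_bounds_le_fix_upper_bounds:
  assumes "finite N" "e \<notin> E" "submodular_on (insert e E) g"
    and hall: "hall_condition own N (insert e E) g u"
    and "a \<in> fix_lower_bounds own N E g u e" "b \<in> fix_upper_bounds own N E g u e"
  shows "a \<le> b"
proof -
  obtain T F where T: "T \<subseteq> N" "own e \<in> T" "covers own E F T" "a = sum u T - g F"
    using assms(5) by (auto simp: fix_lower_bounds_def)
  obtain T' F' where T': "T' \<subseteq> N" "own e \<notin> T'" "covers own E F' T'" "b = g (insert e F') - sum u T'"
    using assms(6) by (auto simp: fix_upper_bounds_def)
  have "sum u (T \<union> T') \<le> g (F \<union> insert e F')" "sum u (T \<inter> T') \<le> g (F \<inter> insert e F')"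
    using T T' assms(2) by (intro hall_conditionD[OF hall]; auto simp: covers_def)+
  moreover have "g (F \<union> insert e F') + g (F \<inter> insert e F') \<le> g F + g (insert e F')"
    using T T' by (intro submodular_onD[OF assms(3)]) (auto simp: covers_def)
  moreover have "sum u (T \<union> T') + sum u (T \<inter> T') = sum u T + sum u T'"
    using T(1) T'(1) assms(1) by (intro sum.union_inter) (auto intro: finite_subset)
  ultimately show ?thesis
    using T(4) T'(4) by linarith
qed

lemma hall_condition_fix_value_exists:
  assumes "finite E" "finite N" "e \<notin> E" "0 \<le> u (own e)" "g {} = 0"
    and g: "submodular_on (insert e E) g" and hall: "hall_condition own N (insert e E) g u"
  obtains a where "0 \<le> a" "a \<le> u (own e)" "fix_value g e a {} = 0"
    "hall_condition own N E (fix_value g e a) (u(own e := u (own e) - a))"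
proof -
  let ?L = "fix_lower_bounds own N E g u e" and ?U = "fix_upper_bounds own N E g u e"
  have "?L \<subseteq> (\<lambda>(T, F). sum u T - g F) ` (Pow N \<times> Pow E)"
    by (auto simp: fix_lower_bounds_def covers_def)
  then have "finite (insert 0 ?L)"
    using assms(1,2) by (simp add: finite_subset)
  moreover have "a \<le> b" if "a \<in> insert 0 ?L" "b \<in> insert (u (own e)) ?U" for a b
    using that assms(4) fix_lower_bounds_le[OF assms(2) hall] fix_upper_bounds_nonneg[OF hall]
      fix_lower_bounds_le_fix_upper_bounds[OF assms(2,3) g hall] by blast
  ultimately obtain a where a: "\<And>b. b \<in> insert 0 ?L \<Longrightarrow> b \<le> a"
    "\<And>b. b \<in> insert (u (own e)) ?U \<Longrightarrow> a \<le> b"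
    using finite_between[of "insert 0 ?L" "insert (u (own e)) ?U"] by blast
  have "covers own E {} {}"
    by (simp add: covers_def)
  then have "g {e} \<in> ?U"
    unfolding fix_upper_bounds_def by (force intro!: exI[of _ "{}"])
  then have "fix_value g e a {} = 0"
    using a(2) assms(5) by (simp add: fix_value_def)
  then show thesis
    using a hall_condition_fix_value[OF assms(2) hall, of a] by (intro that) auto
qed

lemma sum_fibre_insert:
  assumes "finite E" "e \<notin> E"
  shows "sum (y(e := a)) {x \<in> insert e E. own x = k} =
    sum y {x \<in> E. own x = k} + (if own e = k then a else 0)"
proof -
  have "{x \<in> insert e E. own x = k} =
      (if own e = k then insert e {x \<in> E. own x = k} else {x \<in> E. own x = k})"
    by auto
  moreover have "sum (y(e := a)) {x \<in> E. own x = k} = sum y {x \<in> E. own x = k}"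
    using assms(2) by (intro sum.cong) auto
  ultimately show ?thesis
    using assms by (auto simp: add.commute)
qed

theorem polymatroid_aggregate_realization:
  assumes "finite E" "finite N" "own ` E \<subseteq> N" "submodular_on E g" "g {} = 0"
    and "\<And>k. k \<in> N \<Longrightarrow> 0 \<le> u k" "hall_condition own N E g u"
  shows "\<exists>y\<in>polymatroid E g. \<forall>k\<in>N. sum y {e \<in> E. own e = k} = u k"
  using assms(1,3-)
proof (induction E arbitrary: g u rule: finite_induct)
  case empty
  have "u k = 0" if "k \<in> N" for k
    using hall_conditionD[OF empty.prems(5), of "{k}" "{}"] empty.prems(3) empty.prems(4)[OF that] that
    by (auto simp: covers_def)
  then show ?case
    using empty.prems(3) by (intro bexI[of _ "\<lambda>_. 0"]) (auto intro: polymatroidI)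
next
  case (insert e E)
  have "0 \<le> u (own e)"
    using insert.prems(1,4) by auto
  then obtain a where a: "0 \<le> a" "a \<le> u (own e)" "fix_value g e a {} = 0"
      "hall_condition own N E (fix_value g e a) (u(own e := u (own e) - a))"
    using assms(2) insert.hyps insert.prems(2,3,5) hall_condition_fix_value_exists by metis
  let ?u = "u(own e := u (own e) - a)"
  have "\<exists>y\<in>polymatroid E (fix_value g e a). \<forall>k\<in>N. sum y {e \<in> E. own e = k} = ?u k"
  proof (rule insert.IH)
    show "submodular_on E (fix_value g e a)"
      using insert.prems(2) insert.hyps(2) by (rule submodular_on_fix_value)
    show "hall_condition own N E (fix_value g e a) ?u"
      by (rule a(4))
  qed (use insert.prems(1,4) a(2,3) in auto)
  then obtain y where y: "y \<in> polymatroid E (fix_value g e a)"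
    "\<And>k. k \<in> N \<Longrightarrow> sum y {e \<in> E. own e = k} = ?u k"
    by blast
  then have "sum (y(e := a)) {x \<in> insert e E. own x = k} = u k" if "k \<in> N" for k
    using that unfolding sum_fibre_insert[OF insert.hyps] by simp
  then show ?case
    using polymatroid_fix_value_insert[OF insert.hyps a(1) y(1)] by blast
qed

section \<open>The rank of a set of owners under demand caps\<close>

lemma covers_Un: "covers own E F T \<Longrightarrow> covers own E G U \<Longrightarrow> covers own E (F \<union> G) (T \<union> U)"
  and covers_Int: "covers own E F T \<Longrightarrow> covers own E G U \<Longrightarrow> covers own E (F \<inter> G) (T \<inter> U)"
  and covers_antimono: "covers own E F T \<Longrightarrow> U \<subseteq> T \<Longrightarrow> covers own E F U"
  by (auto simp: covers_def)

locale ownership =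
  fixes E :: "'e set" and N :: "'n set" and own :: "'e \<Rightarrow> 'n"
  assumes finite_E: "finite E" and finite_N: "finite N" and own_E: "own ` E \<subseteq> N"
begin

definition edges :: "'n set \<Rightarrow> 'e set" where
  "edges T = {e \<in> E. own e \<in> T}"

definition load :: "('e \<Rightarrow> real) \<Rightarrow> 'n \<Rightarrow> real" where
  "load y k = sum y {e \<in> E. own e = k}"

abbreviation caps :: "('n \<Rightarrow> ereal) \<Rightarrow> 'n set \<Rightarrow> real" where
  "caps D A \<equiv> (\<Sum>k\<in>A. real_of_ereal (D k))"

text \<open>Since \<open>real_of_ereal \<infinity> = 0\<close>, owners whose demand is uncapped must belong to \<open>H\<close>.\<close>

definition dual_solution :: "('n \<Rightarrow> ereal) \<Rightarrow> 'n set \<Rightarrow> 'e set \<Rightarrow> 'n set \<Rightarrow> bool" where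
  "dual_solution D S F H \<longleftrightarrow> H \<subseteq> S \<and> covers own E F H \<and> (\<forall>k\<in>S - H. D k \<noteq> \<infinity>)"

definition rank :: "('e set \<Rightarrow> real) \<Rightarrow> ('n \<Rightarrow> ereal) \<Rightarrow> 'n set \<Rightarrow> real" where
  "rank g D S = Min {g F + caps D (S - H) | F H. dual_solution D S F H}"

definition feasible :: "('e set \<Rightarrow> real) \<Rightarrow> ('n \<Rightarrow> ereal) \<Rightarrow> ('e \<Rightarrow> real) set" where
  "feasible g D = {y \<in> polymatroid E g. \<forall>k\<in>N. ereal (load y k) \<le> D k}"

lemma finite_edges [simp]: "F \<subseteq> E \<Longrightarrow> finite F"
  using finite_E by (rule rev_finite_subset)

lemma finite_owners [simp]: "S \<subseteq> N \<Longrightarrow> finite S"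
  using finite_N by (rule rev_finite_subset)

lemma edges_subset: "edges T \<subseteq> E"
  by (auto simp: edges_def)

lemma covers_edges: "covers own E (edges T) T"
  by (auto simp: covers_def edges_def)

lemma edges_subset_cover: "covers own E F T \<Longrightarrow> edges T \<subseteq> F"
  by (auto simp: covers_def edges_def)

lemma cover_subset: "covers own E F T \<Longrightarrow> F \<subseteq> E"
  by (simp add: covers_def)

lemma sum_edges:
  assumes "T \<subseteq> N"
  shows "sum y (edges T) = sum (load y) T"
proof -
  have "sum (load y) T = (\<Sum>k\<in>T. sum y {e \<in> edges T. own e = k})"
    by (auto simp: load_def edges_def intro!: sum.cong)
  also have "\<dots> = sum y (edges T)"
    using assms by (intro sum.group) (auto simp: edges_subset edges_def)
  finally show ?thesis by simp
qed

lemma load_add: "load (\<lambda>e. y e + z e) k = load y k + load z k"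
  by (simp add: load_def sum.distrib)

lemma load_outside: "k \<notin> N \<Longrightarrow> load y k = 0"
  using own_E by (auto simp: load_def intro!: sum.neutral)

lemma load_nonneg: "(\<And>e. 0 \<le> y e) \<Longrightarrow> 0 \<le> load y k"
  by (simp add: load_def sum_nonneg)

lemma hall_condition_load:
  assumes "y \<in> polymatroid E h"
  shows "hall_condition own N E h (load y)"
  unfolding hall_condition_def
proof (intro allI impI)
  fix T F assume T: "T \<subseteq> N" "covers own E F T"
  have "sum (load y) T = sum y (edges T)"
    using sum_edges[OF T(1)] by simp
  also have "\<dots> \<le> sum y F"
    using edges_subset_cover[OF T(2)] cover_subset[OF T(2)] polymatroid_nonneg[OF assms]
    by (intro sum_mono2) auto
  also have "\<dots> \<le> h F"
    using polymatroid_sum_le[OF assms cover_subset[OF T(2)]] .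
  finally show "sum (load y) T \<le> h F" .
qed

lemma polymatroid_load_realization:
  assumes "submodular_on E h" "h {} = 0" "hall_condition own N E h u"
    "\<And>k. 0 \<le> u k" "\<And>k. k \<notin> N \<Longrightarrow> u k = 0"
  obtains y where "y \<in> polymatroid E h" "load y = u"
proof -
  obtain y where y: "y \<in> polymatroid E h" "\<forall>k\<in>N. load y k = u k"
    using polymatroid_aggregate_realization[OF finite_E finite_N own_E assms(1,2,4,3)]
    unfolding load_def by blast
  moreover have "load y k = u k" for k
    using y(2) load_outside assms(5) by (cases "k \<in> N") auto
  ultimately show thesis
    using that by blast
qed

lemma dual_solutions_finite:
  assumes "S \<subseteq> N"
  shows "finite {g F + caps D (S - H) | F H. dual_solution D S F H}"
proof -
  have "{g F + caps D (S - H) | F H. dual_solution D S F H}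
      \<subseteq> (\<lambda>(F, H). g F + caps D (S - H)) ` (Pow E \<times> Pow S)"
    by (auto simp: dual_solution_def covers_def)
  then show ?thesis
    using finite_E assms by (simp add: finite_subset)
qed

lemma rank_le:
  assumes "dual_solution D S F H" "S \<subseteq> N"
  shows "rank g D S \<le> g F + caps D (S - H)"
  unfolding rank_def using dual_solutions_finite[OF assms(2)] assms(1) by (intro Min_le) auto

lemma rank_attained:
  assumes "S \<subseteq> N"
  obtains F H where "dual_solution D S F H" "rank g D S = g F + caps D (S - H)"
proof -
  have "dual_solution D S (edges S) S"
    by (simp add: dual_solution_def covers_edges)
  then have "{g F + caps D (S - H) | F H. dual_solution D S F H} \<noteq> {}"
    by blast
  from Min_in[OF dual_solutions_finite[OF assms] this] show thesis
    using that by (auto simp: rank_def)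
qed

lemma rank_le_cover: "T \<subseteq> N \<Longrightarrow> covers own E F T \<Longrightarrow> rank g D T \<le> g F"
  using rank_le[of D T F T g] by (simp add: dual_solution_def)

lemma rank_le_add_caps:
  assumes "S \<subseteq> N" "H \<subseteq> S" "\<And>k. k \<in> S - H \<Longrightarrow> D k \<noteq> \<infinity>"
  shows "rank g D S \<le> rank g D H + caps D (S - H)"
proof -
  obtain F H' where H': "dual_solution D H F H'" "rank g D H = g F + caps D (H - H')"
    using rank_attained[of H] assms by blast
  have "dual_solution D S F H'"
    using H'(1) assms(2,3) unfolding dual_solution_def by blast
  then have "rank g D S \<le> g F + caps D (S - H')"
    using assms(1) by (rule rank_le)
  also have "caps D (S - H') = caps D (S - H) + caps D (H - H')"
  proof -
    have "S - H' = (S - H) \<union> (H - H')" "(S - H) \<inter> (H - H') = {}"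
      using H'(1) assms(2) by (auto simp: dual_solution_def)
    then show ?thesis
      using assms by (simp add: sum.union_disjoint)
  qed
  finally show ?thesis using H'(2) by simp
qed

lemma caps_fun_upd:
  assumes "finite A"
  shows "caps (D(l := d)) A = (if l \<in> A then real_of_ereal d + caps D (A - {l}) else caps D A)"
proof -
  have "caps (D(l := d)) (A - {l}) = caps D (A - {l})"
    by (intro sum.cong) auto
  then show ?thesis
    using assms by (cases "l \<in> A") (simp_all add: sum.remove)
qed

lemma sum_le_caps:
  assumes "\<And>k. k \<in> A \<Longrightarrow> D k \<noteq> \<infinity>" "\<And>k. k \<in> A \<Longrightarrow> ereal (u k) \<le> D k"
  shows "sum u A \<le> caps D A"
proof (rule sum_mono)
  show "u k \<le> real_of_ereal (D k)" if "k \<in> A" for k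
    using assms[OF that] by (cases "D k") auto
qed

lemma rank_cong:
  assumes "\<And>k. k \<in> S \<Longrightarrow> D k = D' k"
  shows "rank g D S = rank g D' S"
proof -
  have "dual_solution D S F H = dual_solution D' S F H" for F H
    using assms by (auto simp: dual_solution_def)
  moreover have "caps D (S - H) = caps D' (S - H)" for H
    using assms by (intro sum.cong) auto
  ultimately show ?thesis
    by (simp only: rank_def)
qed

lemma rank_fun_upd_cases:
  assumes "S \<subseteq> N" "l \<in> S"
  shows "rank g D S \<le> rank g (D(l := d)) S \<or>
    d \<noteq> \<infinity> \<and> rank g D (S - {l}) + real_of_ereal d \<le> rank g (D(l := d)) S"
proof -
  obtain F H where opt: "dual_solution (D(l := d)) S F H"
    "rank g (D(l := d)) S = g F + caps (D(l := d)) (S - H)"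
    using rank_attained[OF assms(1)] .
  then have H: "H \<subseteq> S" "covers own E F H" and finite_caps: "\<And>k. k \<in> S - H \<Longrightarrow> (D(l := d)) k \<noteq> \<infinity>"
    unfolding dual_solution_def by blast+
  have caps: "caps (D(l := d)) (S - H) =
      (if l \<in> S - H then real_of_ereal d + caps D (S - H - {l}) else caps D (S - H))"
    using assms(1) by (intro caps_fun_upd) simp
  show ?thesis
  proof (cases "l \<in> H")
    case True
    then have "D k \<noteq> \<infinity>" if "k \<in> S - H" for k
      using finite_caps[OF that] that by (auto split: if_splits)
    then have "rank g D S \<le> g F + caps D (S - H)"
      using H assms(1) by (intro rank_le) (auto simp: dual_solution_def)
    then show ?thesis
      using True unfolding opt(2) caps by simp
  next
    case False
    then have "D k \<noteq> \<infinity>" if "k \<in> S - {l} - H" for k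
      using finite_caps[of k] that by (auto split: if_splits)
    then have "rank g D (S - {l}) \<le> g F + caps D (S - {l} - H)"
      using H False assms(1) by (intro rank_le) (auto simp: dual_solution_def)
    moreover have "S - H - {l} = S - {l} - H" "d \<noteq> \<infinity>"
      using finite_caps[of l] False assms(2) by auto
    ultimately show ?thesis
      using False assms(2) unfolding opt(2) caps by simp
  qed
qed

end

locale capped_polymatroid = ownership E N own
  for E :: "'e set" and N :: "'n set" and own :: "'e \<Rightarrow> 'n" +
  fixes g :: "'e set \<Rightarrow> real" and D :: "'n \<Rightarrow> ereal"
  assumes submodular: "submodular_on E g" and g_empty: "g {} = 0"
    and g_nonneg: "\<And>F. F \<subseteq> E \<Longrightarrow> 0 \<le> g F"
    and D_nonneg: "\<And>k. k \<in> N \<Longrightarrow> 0 \<le> D k"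
begin

lemma le_cap_iff: "k \<in> N \<Longrightarrow> D k \<noteq> \<infinity> \<Longrightarrow> ereal t \<le> D k \<longleftrightarrow> t \<le> real_of_ereal (D k)"
  and cap_le_iff: "k \<in> N \<Longrightarrow> D k \<noteq> \<infinity> \<Longrightarrow> D k \<le> ereal t \<longleftrightarrow> real_of_ereal (D k) \<le> t"
  using D_nonneg[of k] by (cases "D k"; simp)+

abbreviation rk :: "'n set \<Rightarrow> real" where
  "rk \<equiv> rank g D"

lemma caps_mono: "A \<subseteq> B \<Longrightarrow> B \<subseteq> N \<Longrightarrow> caps D A \<le> caps D B"
  using D_nonneg by (intro sum_mono2) (auto simp: real_of_ereal_pos)

lemma caps_Un_Int: "A \<subseteq> N \<Longrightarrow> B \<subseteq> N \<Longrightarrow> caps D (A \<union> B) + caps D (A \<inter> B) = caps D A + caps D B"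
  by (intro sum.union_inter) auto

lemma rank_nonneg:
  assumes "S \<subseteq> N"
  shows "0 \<le> rk S"
proof -
  obtain F H where "dual_solution D S F H" "rk S = g F + caps D (S - H)"
    using rank_attained[OF assms] .
  moreover from this have "0 \<le> g F" "0 \<le> caps D (S - H)"
    using g_nonneg caps_mono[of "{}" "S - H"] assms by (auto simp: dual_solution_def covers_def)
  ultimately show ?thesis by simp
qed

lemma rank_empty: "rk {} = 0"
  using rank_le_cover[of "{}" "{}" g D] rank_nonneg[of "{}"] g_empty by (simp add: covers_def)

lemma mono_on_rank: "mono_on (Pow N) rk"
proof (rule mono_onI)
  fix S T assume ST: "S \<in> Pow N" "T \<in> Pow N" "S \<subseteq> T"
  obtain F H where opt: "dual_solution D T F H" "rk T = g F + caps D (T - H)"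
    using rank_attained[of T] ST(2) by blast
  then have "rk S \<le> g F + caps D (S - (H \<inter> S))"
    using ST by (intro rank_le) (auto simp: dual_solution_def intro: covers_antimono)
  also have "\<dots> \<le> g F + caps D (T - H)"
    using ST by (intro add_left_mono caps_mono) auto
  finally show "rk S \<le> rk T" using opt by simp
qed

lemma submodular_on_rank: "submodular_on N rk"
proof (rule submodular_onI)
  fix S T assume ST: "S \<subseteq> N" "T \<subseteq> N"
  obtain F H where S: "dual_solution D S F H" "rk S = g F + caps D (S - H)"
    using rank_attained[OF ST(1)] .
  obtain F' H' where T: "dual_solution D T F' H'" "rk T = g F' + caps D (T - H')"
    using rank_attained[OF ST(2)] .
  define A where "A = S \<union> T - (H \<union> H')"
  define B where "B = S \<inter> T - (H \<inter> H')"
  have "dual_solution D (S \<union> T) (F \<union> F') (H \<union> H')" "dual_solution D (S \<inter> T) (F \<inter> F') (H \<inter> H')"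
    using S T by (auto simp: dual_solution_def intro: covers_Un covers_Int)
  then have "rk (S \<union> T) \<le> g (F \<union> F') + caps D A" "rk (S \<inter> T) \<le> g (F \<inter> F') + caps D B"
    unfolding A_def B_def using ST by (intro rank_le; auto)+
  moreover have "g (F \<union> F') + g (F \<inter> F') \<le> g F + g F'"
    using S T by (intro submodular_onD[OF submodular]) (auto simp: dual_solution_def covers_def)
  moreover have "caps D A + caps D B \<le> caps D (S - H) + caps D (T - H')"
  proof -
    have "caps D A + caps D B = caps D (A \<union> B) + caps D (A \<inter> B)"
      using ST by (intro caps_Un_Int[symmetric]) (auto simp: A_def B_def)
    also have "\<dots> \<le> caps D ((S - H) \<union> (T - H')) + caps D ((S - H) \<inter> (T - H'))"
      using ST by (intro add_mono caps_mono) (auto simp: A_def B_def)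
    also have "\<dots> = caps D (S - H) + caps D (T - H')"
      using ST by (intro caps_Un_Int) auto
    finally show ?thesis .
  qed
  ultimately show "rk (S \<union> T) + rk (S \<inter> T) \<le> rk S + rk T"
    using S T by linarith
qed

lemma rank_base_exists:
  assumes "S \<subseteq> N"
  shows "\<exists>u\<in>polymatroid S rk. sum u S = rk S"
proof (rule polymatroid_base_exists)
  show "submodular_on S rk"
    using submodular_on_rank assms by (rule submodular_on_subset)
  show "mono_on (Pow S) rk"
    using mono_on_rank by (rule mono_on_subset) (use assms in auto)
qed (use assms rank_empty in simp_all)

lemma polymatroid_rank_extend: "S \<subseteq> N \<Longrightarrow> u \<in> polymatroid S rk \<Longrightarrow> u \<in> polymatroid N rk"
  by (rule polymatroid_extend[OF finite_N _ mono_on_rank])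

lemma polymatroid_rank_hall:
  assumes "u \<in> polymatroid N rk"
  shows "hall_condition own N E g u"
  unfolding hall_condition_def
proof (intro allI impI)
  fix T F assume T: "T \<subseteq> N" "covers own E F T"
  show "sum u T \<le> g F"
    using polymatroid_sum_le[OF assms T(1)] rank_le_cover[OF T] by (rule order_trans)
qed

lemma polymatroid_rank_cap:
  assumes "u \<in> polymatroid N rk" "k \<in> N"
  shows "ereal (u k) \<le> D k"
proof (cases "D k = \<infinity>")
  case False
  have "u k \<le> rk {k}"
    using polymatroid_sum_le[OF assms(1), of "{k}"] assms(2) by simp
  also have "\<dots> \<le> real_of_ereal (D k)"
    using rank_le_add_caps[of "{k}" "{}" D g] assms(2) False rank_empty by simp
  finally show ?thesis
    using le_cap_iff[OF assms(2) False] by simp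
qed simp

lemma polymatroid_rankI:
  assumes "\<And>k. 0 \<le> u k" "\<And>k. k \<notin> N \<Longrightarrow> u k = 0" "hall_condition own N E g u"
    "\<And>k. k \<in> N \<Longrightarrow> ereal (u k) \<le> D k"
  shows "u \<in> polymatroid N rk"
proof (rule polymatroidI)
  fix T assume T: "T \<subseteq> N"
  obtain F H where opt: "dual_solution D T F H" "rk T = g F + caps D (T - H)"
    using rank_attained[OF T] .
  have "sum u T = sum u (T - H) + sum u H"
    using opt(1) T by (intro sum.subset_diff) (auto simp: dual_solution_def)
  also have "sum u H \<le> g F"
    using opt(1) T by (intro hall_conditionD[OF assms(3)]) (auto simp: dual_solution_def)
  also have "sum u (T - H) \<le> caps D (T - H)"
    using opt(1) T assms(4) by (intro sum_le_caps) (auto simp: dual_solution_def)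
  finally show "sum u T \<le> rk T" using opt(2) by simp
qed (use assms(1,2) in auto)

theorem load_image_feasible: "load ` feasible g D = polymatroid N rk"
proof (intro equalityI subsetI)
  fix u assume "u \<in> load ` feasible g D"
  then obtain y where y: "y \<in> polymatroid E g" "\<And>k. k \<in> N \<Longrightarrow> ereal (load y k) \<le> D k" "u = load y"
    by (auto simp: feasible_def)
  show "u \<in> polymatroid N rk"
    unfolding y(3)
  proof (rule polymatroid_rankI)
    show "hall_condition own N E g (load y)"
      using y(1) by (rule hall_condition_load)
  qed (use y(2) load_outside load_nonneg[OF polymatroid_nonneg[OF y(1)]] in auto)
next
  fix u assume u: "u \<in> polymatroid N rk"
  obtain y where "y \<in> polymatroid E g" "load y = u"
    using submodular g_empty polymatroid_rank_hall[OF u] polymatroid_nonneg[OF u]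
      polymatroid_outside[OF u] by (rule polymatroid_load_realization)
  moreover from this have "y \<in> feasible g D"
    using polymatroid_rank_cap[OF u] by (simp add: feasible_def)
  ultimately show "u \<in> load ` feasible g D" by blast
qed

lemma rank_marginal_le_cap:
  assumes "S \<subseteq> N" "i \<in> N - S"
  shows "ereal (rk (insert i S) - rk S) \<le> D i"
proof (cases "D i = \<infinity>")
  case False
  have "insert i S - S = {i}" using assms by auto
  then have "rk (insert i S) \<le> rk S + real_of_ereal (D i)"
    using rank_le_add_caps[of "insert i S" S D g] assms False by auto
  then show ?thesis
    using le_cap_iff[of i] assms(2) False by simp
qed simp

lemma rank_marginal_le:
  assumes "S \<subseteq> N" "i \<in> N - S" "x \<in> polymatroid S rk" "H \<subseteq> S"
  shows "rk (insert i S) - rk S \<le> g (edges (insert i H)) - sum x H"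
proof -
  have "rk (S \<union> insert i H) + rk (S \<inter> insert i H) \<le> rk S + rk (insert i H)"
    using assms by (intro submodular_onD[OF submodular_on_rank]) auto
  moreover have "S \<union> insert i H = insert i S" "S \<inter> insert i H = H"
    using assms by auto
  moreover have "rk (insert i H) \<le> g (edges (insert i H))"
    using assms covers_edges by (intro rank_le_cover) auto
  ultimately show ?thesis
    using polymatroid_sum_le[OF assms(3,4)] by simp
qed

lemma rank_marginal_ge_cap:
  assumes "S \<subseteq> N" "i \<in> N - S" "dual_solution D (insert i S) F H" "i \<notin> H"
  shows "D i \<le> ereal (g F + caps D (insert i S - H) - rk S)"
proof -
  have "dual_solution D S F H" "D i \<noteq> \<infinity>" "insert i S - H = insert i (S - H)"
    using assms(3,4) by (auto simp: dual_solution_def)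
  moreover from this have "rk S \<le> g F + caps D (S - H)"
    using assms(1) by (intro rank_le)
  ultimately show ?thesis
    using assms(1,2) by (simp add: cap_le_iff)
qed

lemma rank_marginal_ge:
  assumes "mono_on (Pow E) g" "S \<subseteq> N" "i \<in> N - S" and x: "x \<in> polymatroid S rk" "sum x S = rk S"
    and dual: "dual_solution D (insert i S) F H" "i \<in> H"
  shows "g (edges H) - sum x (H - {i}) \<le> g F + caps D (insert i S - H) - rk S"
proof -
  have "g (edges H) \<le> g F"
    using dual(1)
    by (intro mono_onD[OF assms(1)]) (auto simp: dual_solution_def covers_def edges_def)
  moreover have "sum x (S - H) \<le> caps D (S - H)"
    using dual(1) assms(2) polymatroid_rank_cap[OF polymatroid_rank_extend[OF assms(2) x(1)]]
    by (intro sum_le_caps) (auto simp: dual_solution_def)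
  moreover have H: "H - {i} \<subseteq> S" "insert i S - H = S - H" "S - (H - {i}) = S - H"
    using dual assms(3) by (auto simp: dual_solution_def)
  moreover have "sum x S = sum x (S - (H - {i})) + sum x (H - {i})"
    using H(1) assms(2) by (intro sum.subset_diff) auto
  ultimately show ?thesis
    using x(2) by simp
qed

lemma rank_marginal:
  assumes "mono_on (Pow E) g" "S \<subseteq> N" "i \<in> N - S" "x \<in> polymatroid S rk" "sum x S = rk S"
  shows "ereal (rk (insert i S) - rk S) =
    min (D i) (ereal (Min {g (edges (insert i H)) - sum x H | H. H \<subseteq> S}))"
proof -
  let ?Q = "(\<lambda>H. g (edges (insert i H)) - sum x H) ` Pow S"
  have Q: "finite ?Q" "?Q \<noteq> {}"
    using assms(2) by auto
  have "ereal (rk (insert i S) - rk S) \<le> D i"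
    using rank_marginal_le_cap assms by blast
  moreover have "rk (insert i S) - rk S \<le> Min ?Q"
    using Q rank_marginal_le assms by auto
  moreover have "D i \<le> ereal (rk (insert i S) - rk S) \<or> Min ?Q \<le> rk (insert i S) - rk S"
  proof -
    obtain F H where opt: "dual_solution D (insert i S) F H"
      "rk (insert i S) = g F + caps D (insert i S - H)"
      using rank_attained[of "insert i S"] assms(2,3) by blast
    show ?thesis
    proof (cases "i \<in> H")
      case True
      then have "H - {i} \<subseteq> S" "insert i (H - {i}) = H"
        using opt(1) by (auto simp: dual_solution_def)
      then have "Min ?Q \<le> g (edges H) - sum x (H - {i})"
        using Q(1) by (intro Min_le image_eqI[of _ _ "H - {i}"]) auto
      also have "\<dots> \<le> rk (insert i S) - rk S"
        unfolding opt(2) using assms opt(1) True by (rule rank_marginal_ge)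
      finally show ?thesis ..
    qed (use rank_marginal_ge_cap[OF assms(2,3) opt(1)] opt(2) in simp)
  qed
  moreover have "{g (edges (insert i H)) - sum x H | H. H \<subseteq> S} = ?Q"
    by auto
  ultimately show ?thesis
    by (intro antisym) (simp_all add: min_le_iff_disj)
qed

end

section \<open>Clinching\<close>

context ownership
begin

definition projections ::
  "('e set \<Rightarrow> real) \<Rightarrow> ('n \<Rightarrow> ereal) \<Rightarrow> 'n \<Rightarrow> ('e \<Rightarrow> real) \<Rightarrow> ('n \<Rightarrow> real) set" where
  "projections g D i xi =
     {\<lambda>k. if k \<in> N - {i} then load y k else 0 | y. y \<in> feasible g D \<and> (\<forall>e\<in>edges {i}. y e = xi e)}"

definition supported_by :: "'n \<Rightarrow> ('e \<Rightarrow> real) \<Rightarrow> bool" where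
  "supported_by i xi \<longleftrightarrow> (\<forall>e. 0 \<le> xi e) \<and> (\<forall>e. e \<notin> edges {i} \<longrightarrow> xi e = 0)"

definition clinch_vector :: "('e set \<Rightarrow> real) \<Rightarrow> ('n \<Rightarrow> ereal) \<Rightarrow> 'n \<Rightarrow> ('e \<Rightarrow> real) \<Rightarrow> bool" where
  "clinch_vector g D i xi \<longleftrightarrow> supported_by i xi \<and> ereal (load xi i) \<le> D i \<and>
     (\<forall>T\<subseteq>N - {i}. \<forall>F. covers own E F T \<longrightarrow> rank g D T + sum xi F \<le> g F)"

lemma clinch_vectorD:
  assumes "clinch_vector g D i xi"
  shows "supported_by i xi" "ereal (load xi i) \<le> D i"
    "\<And>T F. T \<subseteq> N - {i} \<Longrightarrow> covers own E F T \<Longrightarrow> rank g D T + sum xi F \<le> g F"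
  using assms by (auto simp: clinch_vector_def)

lemma supported_by_nonneg: "supported_by i xi \<Longrightarrow> 0 \<le> xi e"
  and supported_by_outside: "supported_by i xi \<Longrightarrow> e \<notin> edges {i} \<Longrightarrow> xi e = 0"
  by (auto simp: supported_by_def)

lemma load_supported_by: "supported_by i xi \<Longrightarrow> load xi k = (if k = i then load xi i else 0)"
  by (auto simp: supported_by_def edges_def load_def intro!: sum.neutral)

lemma sum_supported_by:
  "supported_by i xi \<Longrightarrow> F \<subseteq> E \<Longrightarrow> sum xi F = sum xi (F \<inter> edges {i})"
  by (intro sum.mono_neutral_right) (auto simp: supported_by_outside)

lemma sum_supported_by_cover:
  assumes "supported_by i xi" "covers own E F T" "i \<in> T"
  shows "sum xi F = load xi i"
proof -
  have "F \<inter> edges {i} = {e \<in> E. own e = i}"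
    using assms(2,3) by (auto simp: covers_def edges_def)
  then show ?thesis
    using sum_supported_by[OF assms(1) cover_subset[OF assms(2)]] by (simp add: load_def)
qed

lemma sum_load_add_sum_le:
  assumes y: "y \<in> polymatroid E h" and T: "T \<subseteq> N - {i}" "covers own E F T"
  shows "sum (load y) T + sum y (F \<inter> edges {i}) \<le> h F"
proof -
  have "sum (load y) T + sum y (F \<inter> edges {i}) = sum y (edges T) + sum y (F \<inter> edges {i})"
    using T(1) by (subst sum_edges) auto
  also have "\<dots> = sum y (edges T \<union> F \<inter> edges {i})"
    using T by (intro sum.union_disjoint[symmetric]) (auto simp: edges_def)
  also have "\<dots> \<le> sum y F"
    using cover_subset[OF T(2)] edges_subset_cover[OF T(2)] polymatroid_nonneg[OF y]
    by (intro sum_mono2) auto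
  also have "\<dots> \<le> h F"
    using polymatroid_sum_le[OF y cover_subset[OF T(2)]] .
  finally show ?thesis .
qed

lemma load_eq_0_imp:
  assumes "\<And>e. 0 \<le> y e" "load y i = 0" "e \<in> edges {i}"
  shows "y e = 0"
proof -
  have "finite {e \<in> E. own e = i}" by simp
  then show ?thesis
    using assms by (simp add: load_def edges_def sum_nonneg_eq_0_iff)
qed

end

context capped_polymatroid
begin

lemma feasible_with_load:
  assumes "u \<in> polymatroid N rk"
  obtains y where "y \<in> feasible g D" "load y = u"
  using assms load_image_feasible by (metis imageE)

lemma projections_subset: "projections g D i xi \<subseteq> polymatroid (N - {i}) rk"
proof
  fix u assume "u \<in> projections g D i xi"
  then obtain y where y: "y \<in> feasible g D" "u = (\<lambda>k. if k \<in> N - {i} then load y k else 0)"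
    by (auto simp: projections_def)
  then have "load y \<in> polymatroid N rk"
    using load_image_feasible by blast
  then show "u \<in> polymatroid (N - {i}) rk"
    unfolding y(2) by (rule polymatroid_restrict) auto
qed

lemma projections_zero: "projections g D i (\<lambda>_. 0) = polymatroid (N - {i}) rk"
proof
  show "polymatroid (N - {i}) rk \<subseteq> projections g D i (\<lambda>_. 0)"
  proof
    fix u assume u: "u \<in> polymatroid (N - {i}) rk"
    then obtain y where y: "y \<in> feasible g D" "load y = u"
      using polymatroid_rank_extend[of "N - {i}" u] feasible_with_load by auto
    moreover have "u i = 0"
      using u by (rule polymatroid_outside) simp
    moreover have "y \<in> polymatroid E g"
      using y(1) by (simp add: feasible_def)
    ultimately have "\<forall>e\<in>edges {i}. y e = 0"
      using load_eq_0_imp[of y i] polymatroid_nonneg[of y E g] by auto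
    moreover have "u = (\<lambda>k. if k \<in> N - {i} then load y k else 0)"
      using y(2) polymatroid_outside[OF u] by auto
    ultimately show "u \<in> projections g D i (\<lambda>_. 0)"
      using y(1) unfolding projections_def by blast
  qed
qed (rule projections_subset)

lemma clinch_vector_if_projections:
  assumes "supported_by i xi" "i \<in> N" "polymatroid (N - {i}) rk \<subseteq> projections g D i xi"
  shows "clinch_vector g D i xi"
proof -
  have realize: "\<exists>y\<in>feasible g D. (\<forall>e\<in>edges {i}. y e = xi e) \<and> (\<forall>k\<in>N - {i}. load y k = u k)"
    if "u \<in> polymatroid (N - {i}) rk" for u
  proof -
    obtain y where "y \<in> feasible g D" "\<forall>e\<in>edges {i}. y e = xi e"
      "u = (\<lambda>k. if k \<in> N - {i} then load y k else 0)"
      using \<open>u \<in> _\<close> assms(3) unfolding projections_def by blast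
    then show ?thesis by (intro bexI[of _ y]) simp_all
  qed
  have "(\<lambda>_. 0) \<in> polymatroid (N - {i}) rk"
    by (rule polymatroidI) (auto intro: rank_nonneg)
  then obtain y where y: "y \<in> feasible g D" "\<forall>e\<in>edges {i}. y e = xi e"
    using realize by blast
  then have "load xi i = load y i"
    by (simp add: load_def edges_def)
  then have "ereal (load xi i) \<le> D i"
    using y(1) assms(2) by (simp add: feasible_def)
  moreover have "rk T + sum xi F \<le> g F" if T: "T \<subseteq> N - {i}" "covers own E F T" for T F
  proof -
    obtain u where u: "u \<in> polymatroid T rk" "sum u T = rk T"
      using rank_base_exists[of T] T(1) by blast
    have "u \<in> polymatroid (N - {i}) rk"
      using _ T(1) mono_on_subset[OF mono_on_rank] u(1) by (rule polymatroid_extend) auto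
    then obtain y where y: "y \<in> feasible g D" "\<forall>e\<in>edges {i}. y e = xi e"
      "\<forall>k\<in>N - {i}. load y k = u k"
      using realize by blast
    have "sum (load y) T = sum u T"
      using y(3) T(1) by (intro sum.cong) auto
    moreover have "sum xi F = sum y (F \<inter> edges {i})"
      using sum_supported_by[OF assms(1) cover_subset[OF T(2)]] y(2) by simp
    ultimately show ?thesis
      using sum_load_add_sum_le[OF _ T, of y g] y(1) u(2) by (simp add: feasible_def)
  qed
  ultimately show ?thesis
    using assms(1) by (simp add: clinch_vector_def)
qed

lemma hall_condition_clinch:
  assumes xi: "clinch_vector g D i xi" and u: "u \<in> polymatroid (N - {i}) rk"
  shows "hall_condition own N E (\<lambda>F. g F - sum xi F) u"
  unfolding hall_condition_def
proof (intro allI impI)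
  fix T F assume T: "T \<subseteq> N" "covers own E F T"
  then have T': "T - {i} \<subseteq> N - {i}" "covers own E F (T - {i})"
    by (auto intro: covers_antimono)
  have "sum u T = sum u (T - {i})"
    using T(1) polymatroid_outside[OF u] by (intro sum.mono_neutral_right) auto
  also have "\<dots> \<le> rk (T - {i})"
    using polymatroid_sum_le[OF u T'(1)] .
  also have "\<dots> \<le> g F - sum xi F"
    using clinch_vectorD(3)[OF xi T'] by simp
  finally show "sum u T \<le> g F - sum xi F" .
qed

lemma polymatroid_add_supported_by:
  assumes "z \<in> polymatroid E (\<lambda>F. g F - sum xi F)" "supported_by i xi"
  shows "(\<lambda>e. z e + xi e) \<in> polymatroid E g"
proof (rule polymatroidI)
  show "(\<Sum>e\<in>F. z e + xi e) \<le> g F" if "F \<subseteq> E" for F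
    using polymatroid_sum_le[OF assms(1) that] by (simp add: sum.distrib)
  show "z e + xi e = 0" if "e \<notin> E" for e
    using that polymatroid_outside[OF assms(1)] supported_by_outside[OF assms(2)]
    by (auto simp: edges_def)
qed (use polymatroid_nonneg[OF assms(1)] supported_by_nonneg[OF assms(2)] in simp)

lemma projections_if_clinch_vector:
  assumes xi: "clinch_vector g D i xi"
  shows "polymatroid (N - {i}) rk \<subseteq> projections g D i xi"
proof
  fix u assume u: "u \<in> polymatroid (N - {i}) rk"
  note supported = clinch_vectorD(1)[OF xi]
  have uN: "u \<in> polymatroid N rk" and ui: "u i = 0"
    using polymatroid_rank_extend[OF _ u] polymatroid_outside[OF u] by auto
  have "g {} - sum xi {} = 0"
    by (simp add: g_empty)
  then obtain z where z: "z \<in> polymatroid E (\<lambda>F. g F - sum xi F)" "load z = u"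
    using polymatroid_load_realization[OF submodular_on_diff_sum[OF finite_E submodular] _
        hall_condition_clinch[OF xi u]]
      polymatroid_nonneg[OF uN] polymatroid_outside[OF uN] by blast
  define y where "y = (\<lambda>e. z e + xi e)"
  have load_y: "load y k = u k + (if k = i then load xi i else 0)" for k
    using z(2) load_supported_by[OF supported, of k] by (simp add: y_def load_add)
  have "ereal (load y k) \<le> D k" if "k \<in> N" for k
    using clinch_vectorD(2)[OF xi] polymatroid_rank_cap[OF uN that] ui by (simp add: load_y)
  then have "y \<in> feasible g D"
    using polymatroid_add_supported_by[OF z(1) supported] by (simp add: feasible_def y_def)
  moreover have "\<forall>e\<in>edges {i}. y e = xi e"
    using load_eq_0_imp[of z i] polymatroid_nonneg[OF z(1)] ui z(2) by (simp add: y_def)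
  moreover have "u = (\<lambda>k. if k \<in> N - {i} then load y k else 0)"
    using load_y polymatroid_outside[OF u] by auto
  ultimately show "u \<in> projections g D i xi"
    unfolding projections_def by blast
qed

theorem clinch_vector_iff_projections:
  assumes "supported_by i xi" "i \<in> N"
  shows "clinch_vector g D i xi \<longleftrightarrow> projections g D i xi = projections g D i (\<lambda>_. 0)"
  unfolding projections_zero
  using projections_subset[of i xi] clinch_vector_if_projections[OF assms]
    projections_if_clinch_vector by blast

lemma dual_optimum_Un_tight:
  assumes "S \<subseteq> N" and opt: "dual_solution D S F H" "g F + caps D (S - H) \<le> rk S"
    and T: "T \<subseteq> S" "covers own E G T" "g G \<le> rk T"
  shows "dual_solution D S (F \<union> G) (H \<union> T)" "g (F \<union> G) + caps D (S - (H \<union> T)) \<le> rk S"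
proof -
  show "dual_solution D S (F \<union> G) (H \<union> T)"
    using opt(1) T by (auto simp: dual_solution_def intro: covers_Un)
  have "dual_solution D T (F \<inter> G) (H \<inter> T)"
    using opt(1) T by (auto simp: dual_solution_def intro: covers_Int)
  then have "rk T \<le> g (F \<inter> G) + caps D (T - H \<inter> T)"
    using T(1) assms(1) by (intro rank_le) auto
  moreover have "g (F \<union> G) + g (F \<inter> G) \<le> g F + g G"
    using opt(1) T(2)
    by (intro submodular_onD[OF submodular]) (auto simp: dual_solution_def covers_def)
  moreover have "caps D (S - H) = caps D (S - (H \<union> T)) + caps D (T - H \<inter> T)"
  proof -
    have "S - H - (T - H \<inter> T) = S - (H \<union> T)" by auto
    then show ?thesis
      using sum.subset_diff[of "T - H \<inter> T" "S - H" "\<lambda>k. real_of_ereal (D k)"] T(1) assms(1) by auto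
  qed
  ultimately show "g (F \<union> G) + caps D (S - (H \<union> T)) \<le> rk S"
    using opt(2) T(3) by linarith
qed

text \<open>A dual optimum for \<open>S - {i}\<close> with a maximal edge set absorbs all tight sets, so it contains the
  edges of \<open>i\<close> and is a dual solution for \<open>S\<close> as well.\<close>

lemma rank_remove_tight:
  assumes "S \<subseteq> N" "i \<in> S"
    and tight: "\<And>e. e \<in> edges {i} \<Longrightarrow> \<exists>T\<subseteq>S - {i}. \<exists>G. covers own E G T \<and> e \<in> G \<and> g G \<le> rk T"
  shows "rk S \<le> rk (S - {i})"
proof -
  define R where "R = S - {i}"
  have R: "R \<subseteq> N" using assms(1) by (auto simp: R_def)
  define optima where "optima = {F. \<exists>H. dual_solution D R F H \<and> g F + caps D (R - H) \<le> rk R}"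
  obtain F H where "dual_solution D R F H" "rk R = g F + caps D (R - H)"
    using rank_attained[OF R] .
  then have "optima \<noteq> {}"
    unfolding optima_def by auto
  moreover have "finite optima"
    using finite_E
    by (auto simp: optima_def dual_solution_def covers_def intro: finite_subset[of _ "Pow E"])
  ultimately obtain F where F: "F \<in> optima" "\<And>F'. F' \<in> optima \<Longrightarrow> F \<subseteq> F' \<Longrightarrow> F' = F"
    using finite_has_maximal[of optima] by blast
  then obtain H where H: "dual_solution D R F H" "g F + caps D (R - H) \<le> rk R"
    by (auto simp: optima_def)
  have "edges {i} \<subseteq> F"
  proof
    fix e assume "e \<in> edges {i}"
    then obtain T G where G: "T \<subseteq> R" "covers own E G T" "e \<in> G" "g G \<le> rk T"
      using tight[OF \<open>e \<in> edges {i}\<close>] unfolding R_def by blast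
    then have "F \<union> G \<in> optima"
      unfolding optima_def using dual_optimum_Un_tight[OF R H] by blast
    then show "e \<in> F" using F(2)[of "F \<union> G"] G(3) by blast
  qed
  then have "dual_solution D S F (insert i H)"
    using H(1) assms(2) by (auto simp: dual_solution_def covers_def edges_def R_def)
  then have "rk S \<le> g F + caps D (S - insert i H)"
    using assms(1) by (rule rank_le)
  moreover have "S - insert i H = R - H" by (auto simp: R_def)
  ultimately show ?thesis
    using H(2) by (simp add: R_def)
qed

end

locale clinching = capped_polymatroid E N own g D
  for E :: "'e set" and N :: "'n set" and own :: "'e \<Rightarrow> 'n" and g D +
  fixes i :: 'n and xi :: "'e \<Rightarrow> real"
  assumes i_in_N: "i \<in> N" and clinch: "clinch_vector g D i xi"
begin

lemmas xi_supported = clinch_vectorD(1)[OF clinch]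
  and load_le_cap = clinch_vectorD(2)[OF clinch]
  and rank_add_sum_le = clinch_vectorD(3)[OF clinch]

abbreviation g_post :: "'e set \<Rightarrow> real" where
  "g_post \<equiv> \<lambda>F. g F - sum xi F"

abbreviation D_post :: "'n \<Rightarrow> ereal" where
  "D_post \<equiv> D(i := D i - ereal (load xi i))"

sublocale post: capped_polymatroid E N own g_post D_post
proof
  show "submodular_on E g_post"
    using finite_E submodular by (rule submodular_on_diff_sum)
  show "0 \<le> g_post F" if "F \<subseteq> E" for F
    using rank_add_sum_le[of "{}" F] rank_empty that by (simp add: covers_def)
  show "0 \<le> D_post k" if "k \<in> N" for k
    using D_nonneg[OF that] load_le_cap by (cases "D i") auto
qed (simp add: g_empty)

lemma D_post_infinite_iff: "D_post k = \<infinity> \<longleftrightarrow> D k = \<infinity>"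
  by (cases "D i") auto

lemma dual_solution_post: "dual_solution D_post S F H \<longleftrightarrow> dual_solution D S F H"
  unfolding dual_solution_def D_post_infinite_iff ..

lemma caps_post:
  assumes "A \<subseteq> N" "i \<in> A \<Longrightarrow> D i \<noteq> \<infinity>"
  shows "caps D_post A = caps D A - (if i \<in> A then load xi i else 0)"
proof -
  have "caps D_post A = (\<Sum>k\<in>A. real_of_ereal (D k) + (if k = i then - load xi i else 0))"
    using assms(2) D_nonneg[OF i_in_N] by (intro sum.cong) (cases "D i"; auto)+
  then show ?thesis
    using assms(1) by (simp add: sum.distrib)
qed

lemma rank_post_ge:
  assumes S: "S \<subseteq> N"
  shows "rk S - (if i \<in> S then load xi i else 0) \<le> post.rk S"
proof -
  obtain F H where "dual_solution D_post S F H"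
    and post: "post.rk S = g_post F + caps D_post (S - H)"
    using rank_attained[OF S] .
  then have dual: "dual_solution D S F H"
    by (simp only: dual_solution_post)
  have H: "H \<subseteq> S" "covers own E F H" "\<And>k. k \<in> S - H \<Longrightarrow> D k \<noteq> \<infinity>"
    using dual by (auto simp: dual_solution_def)
  have caps: "caps D_post (S - H) = caps D (S - H) - (if i \<in> S - H then load xi i else 0)"
    using H(3)[of i] S by (intro caps_post) auto
  show ?thesis
  proof (cases "i \<in> H")
    case True
    then show ?thesis
      using rank_le[OF dual S, of g] post caps H(1) sum_supported_by_cover[OF xi_supported H(2)]
      by auto
  next
    case False
    then have "H \<subseteq> N - {i}" using H(1) S by blast
    then have "rk H \<le> g_post F"
      using rank_add_sum_le[OF _ H(2)] by simp
    moreover have "rk S \<le> rk H + caps D (S - H)"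
      using S H(1,3) by (rule rank_le_add_caps)
    ultimately show ?thesis
      using post caps False by auto
  qed
qed

lemma rank_post_le:
  assumes S: "S \<subseteq> N" "i \<in> S"
  shows "post.rk S \<le> rk S - load xi i"
proof -
  obtain F H where opt: "dual_solution D S F H" "rk S = g F + caps D (S - H)"
    using rank_attained[OF S(1)] .
  have H: "H \<subseteq> S" "covers own E F H" "\<And>k. k \<in> S - H \<Longrightarrow> D k \<noteq> \<infinity>"
    using opt(1) by (auto simp: dual_solution_def)
  have "post.rk S \<le> g_post F + caps D_post (S - H)"
    using opt(1) S(1) by (intro rank_le) (simp_all only: dual_solution_post)
  moreover have "caps D_post (S - H) = caps D (S - H) - (if i \<in> S - H then load xi i else 0)"
    using H(3)[of i] S by (intro caps_post) auto
  moreover have "sum xi F = load xi i" if "i \<in> H"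
    using sum_supported_by_cover[OF xi_supported H(2) that] .
  moreover have "0 \<le> sum xi F"
    using supported_by_nonneg[OF xi_supported] by (intro sum_nonneg)
  ultimately show ?thesis
    using opt(2) S(2) by (cases "i \<in> H") auto
qed

lemma clinch_vector_increase_edge:
  assumes "e \<in> edges {i}" "0 \<le> \<delta>" "ereal \<delta> \<le> D_post i"
    and gap: "\<And>T F. T \<subseteq> N - {i} \<Longrightarrow> covers own E F T \<Longrightarrow> e \<in> F \<Longrightarrow> rk T + \<delta> \<le> g_post F"
  shows "clinch_vector g D i (xi(e := xi e + \<delta>))"
proof -
  have sum: "sum (xi(e := xi e + \<delta>)) F = sum xi F + (if e \<in> F then \<delta> else 0)" if "F \<subseteq> E" for F
    using that by (simp only: finite_edges sum_fun_upd_add)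
  then have "load (xi(e := xi e + \<delta>)) i = load xi i + \<delta>"
    using assms(1) by (auto simp: load_def edges_def)
  then have "ereal (load (xi(e := xi e + \<delta>)) i) \<le> D i"
    using assms(3) by (cases "D i") auto
  moreover have "supported_by i (xi(e := xi e + \<delta>))"
    using xi_supported assms(1,2) by (auto simp: supported_by_def)
  moreover have "rk T + sum (xi(e := xi e + \<delta>)) F \<le> g F" if "T \<subseteq> N - {i}" "covers own E F T" for T F
    using gap[OF that] rank_add_sum_le[OF that] sum[OF cover_subset[OF that(2)]] by auto
  ultimately show ?thesis
    by (simp add: clinch_vector_def)
qed

lemma maximal_clinch_tight:
  assumes max: "\<And>xi'. clinch_vector g D i xi' \<Longrightarrow> (\<forall>e. xi e \<le> xi' e) \<Longrightarrow> xi' = xi"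
    and "e \<in> edges {i}" "D_post i \<noteq> 0"
  shows "\<exists>T\<subseteq>N - {i}. \<exists>F. covers own E F T \<and> e \<in> F \<and> g_post F \<le> rk T"
proof (rule ccontr)
  assume no_tight: "\<not> ?thesis"
  have gap: "rk T < g_post F" if "T \<subseteq> N - {i}" "covers own E F T" "e \<in> F" for T F
  proof (rule ccontr)
    assume "\<not> rk T < g_post F"
    then show False
      using no_tight that unfolding not_less by blast
  qed
  have "0 < D_post i"
    using post.D_nonneg[OF i_in_N] assms(3) by simp
  then obtain d where d: "0 < d" "ereal d \<le> D_post i"
    by (metis ereal_dense2 ereal_less(2) less_imp_le)
  define gaps where "gaps = {g_post F - rk T | T F. T \<subseteq> N - {i} \<and> covers own E F T \<and> e \<in> F}"
  have "gaps \<subseteq> (\<lambda>(T, F). g_post F - rk T) ` (Pow N \<times> Pow E)"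
    by (auto simp: gaps_def covers_def)
  then have "finite (insert d gaps)"
    using finite_E finite_N by (simp add: finite_subset)
  moreover have "0 < x" if "x \<in> insert d gaps" for x
    using that d(1) gap by (auto simp: gaps_def)
  ultimately obtain \<delta> where \<delta>: "0 < \<delta>" "\<And>x. x \<in> insert d gaps \<Longrightarrow> \<delta> \<le> x"
    using finite_positive_lower_bound[of "insert d gaps"] by blast
  have "ereal \<delta> \<le> D_post i"
    using \<delta>(2)[of d] by (intro order_trans[OF _ d(2)]) simp
  moreover have "rk T + \<delta> \<le> g_post F" if "T \<subseteq> N - {i}" "covers own E F T" "e \<in> F" for T F
  proof -
    have "\<delta> \<le> g_post F - rk T"
      using that by (intro \<delta>(2)) (auto simp: gaps_def)
    then show ?thesis by simp
  qed
  ultimately have "clinch_vector g D i (xi(e := xi e + \<delta>))"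
    using assms(2) \<delta>(1) by (intro clinch_vector_increase_edge) auto
  then have "xi(e := xi e + \<delta>) = xi"
    using \<delta>(1) by (intro max) auto
  then show False
    using \<delta>(1) by (metis add_cancel_right_right fun_upd_same less_irrefl)
qed

theorem maximal_clinch_rank_remove:
  assumes "\<And>xi'. clinch_vector g D i xi' \<Longrightarrow> (\<forall>e. xi e \<le> xi' e) \<Longrightarrow> xi' = xi"
  shows "post.rk N \<le> post.rk (N - {i})"
proof (cases "D_post i = 0")
  case True
  have "N - (N - {i}) = {i}" using i_in_N by auto
  then show ?thesis
    using rank_le_add_caps[of N "N - {i}" D_post g_post] True by auto
next
  case False
  show ?thesis
  proof (rule post.rank_remove_tight[OF order_refl i_in_N])
    fix e assume "e \<in> edges {i}"
    then obtain T F where T: "T \<subseteq> N - {i}" "covers own E F T" "e \<in> F" "g_post F \<le> rk T"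
      using maximal_clinch_tight[OF assms \<open>e \<in> edges {i}\<close> False] by blast
    moreover have "T \<subseteq> N" "i \<notin> T" using T(1) by auto
    then have "rk T \<le> post.rk T"
      using rank_post_ge[of T] by simp
    ultimately show "\<exists>T\<subseteq>N - {i}. \<exists>F. covers own E F T \<and> e \<in> F \<and> g_post F \<le> post.rk T"
      by (meson order_trans)
  qed
qed

end

section \<open>The modified market\<close>

locale market_model =
  fixes M :: market
  assumes E0_sub: "E0 M \<subseteq> {1..nb M} \<times> {1..ms M}"
    and f_empty: "\<forall>j\<in>{1..ms M}. fs M j {} = 0"
    and f_mono: "\<forall>j\<in>{1..ms M}. \<forall>F G. F \<subseteq> G \<and> G \<subseteq> Esel (E0 M) j \<longrightarrow> fs M j F \<le> fs M j G"
    and f_submod: "\<forall>j\<in>{1..ms M}. \<forall>F G. F \<subseteq> Esel (E0 M) j \<and> G \<subseteq> Esel (E0 M) j \<longrightarrow>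
                     fs M j (F \<union> G) + fs M j (F \<inter> G) \<le> fs M j F + fs M j G"
    and v_pos: "\<forall>i\<in>{1..nb M}. 0 < val M i"
    and B_nonneg: "\<forall>i\<in>{1..nb M}. 0 \<le> bud M i"
    and rho_pos: "\<forall>j\<in>{1..ms M}. 0 < rho M j"
begin

abbreviation "E \<equiv> Emod M"
abbreviation "N \<equiv> allN M"
abbreviation "f \<equiv> fN M"
abbreviation "v \<equiv> vm M"
abbreviation "B \<equiv> Bm M"

sublocale ownership E N fst
proof
  have "finite (E0 M)"
    using E0_sub by (rule finite_subset) simp
  moreover have "{(nb M + j, j) | j. j \<in> {1..ms M}} = (\<lambda>j. (nb M + j, j)) ` {1..ms M}"
    by auto
  ultimately show "finite E"
    by (simp add: Emod_def)
  show "fst ` E \<subseteq> N"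
    using E0_sub by (auto simp: Emod_def allN_def)
qed (simp add: allN_def)

lemma Ebuys_eq_edges: "Ebuys E T = edges T"
  by (simp add: Ebuys_def edges_def)

lemma Ebuy_eq_edges: "Ebuy E i = edges {i}"
  by (simp add: Ebuy_def edges_def)

lemma sum_Ebuy: "sum y (Ebuy E i) = load y i"
  by (simp add: Ebuy_def load_def)

lemma vm_pos:
  assumes "k \<in> N"
  shows "0 < v k"
proof (cases "k \<le> nb M")
  case False
  then have "k - nb M \<in> {1..ms M}" using assms by (auto simp: allN_def)
  then show ?thesis using rho_pos False by (simp add: vm_def)
qed (use assms v_pos in \<open>simp add: allN_def vm_def\<close>)

lemma budget_cases:
  assumes "k \<in> N"
  obtains (finite) r where "B k = ereal r" "0 \<le> r" | (infinite) "B k = \<infinity>"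
  using assms B_nonneg that by (cases "k \<le> nb M") (auto simp: allN_def Bm_def)

lemma Esel_without_virtual: "F \<subseteq> Esel E j \<Longrightarrow> (nb M + j, j) \<notin> F \<Longrightarrow> F \<subseteq> Esel (E0 M) j"
  by (auto simp: Esel_def Emod_def)

lemma fext_empty: "j \<in> {1..ms M} \<Longrightarrow> fext M j {} = 0"
  using f_empty by (simp add: fext_def)

lemma mono_on_fext:
  assumes "j \<in> {1..ms M}"
  shows "mono_on (Pow (Esel E j)) (fext M j)"
proof (rule mono_onI)
  fix F G assume FG: "F \<in> Pow (Esel E j)" "G \<in> Pow (Esel E j)" "F \<subseteq> G"
  show "fext M j F \<le> fext M j G"
  proof (cases "(nb M + j, j) \<in> G")
    case True
    then show ?thesis
      using FG assms f_mono Esel_without_virtual[of F j] by (auto simp: fext_def)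
  next
    case False
    then have "G \<subseteq> Esel (E0 M) j" "(nb M + j, j) \<notin> F"
      using FG Esel_without_virtual by auto
    then show ?thesis using False FG(3) assms f_mono by (simp add: fext_def)
  qed
qed

lemma submodular_on_fext:
  assumes j: "j \<in> {1..ms M}"
  shows "submodular_on (Esel E j) (fext M j)"
proof (rule submodular_onI)
  fix F G assume FG: "F \<subseteq> Esel E j" "G \<subseteq> Esel E j"
  have Int_le: "fext M j (F \<inter> G) \<le> fext M j F" "fext M j (F \<inter> G) \<le> fext M j G"
    using FG by (intro mono_onD[OF mono_on_fext[OF j]]; auto)+
  show "fext M j (F \<union> G) + fext M j (F \<inter> G) \<le> fext M j F + fext M j G"
  proof (cases "(nb M + j, j) \<in> F \<union> G")
    case True
    then have "fext M j (F \<union> G) = fext M j F \<or> fext M j (F \<union> G) = fext M j G"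
      by (auto simp: fext_def)
    then show ?thesis using Int_le by auto
  next
    case False
    then show ?thesis
      using f_submod j Esel_without_virtual FG by (simp add: fext_def)
  qed
qed

lemma fN_empty: "f {} = 0"
  using fext_empty by (simp add: fN_def)

lemma fN_mono: "F \<subseteq> G \<Longrightarrow> f F \<le> f G"
  unfolding fN_def by (intro sum_mono mono_onD[OF mono_on_fext]) auto

lemma fN_nonneg: "0 \<le> f F"
  using fN_mono[of "{}" F] fN_empty by simp

lemma submodular_on_fN: "submodular_on E f"
proof (rule submodular_onI)
  fix F G :: "edge set"
  have "fext M j ((F \<union> G) \<inter> Esel E j) + fext M j ((F \<inter> G) \<inter> Esel E j)
      \<le> fext M j (F \<inter> Esel E j) + fext M j (G \<inter> Esel E j)" if "j \<in> {1..ms M}" for j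
    using submodular_onD[OF submodular_on_fext[OF that], of "F \<inter> Esel E j" "G \<inter> Esel E j"]
    by (simp add: Int_Un_distrib2 Int_ac)
  then show "f (F \<union> G) + f (F \<inter> G) \<le> f F + f G"
    unfolding fN_def sum.distrib[symmetric] by (rule sum_mono)
qed

lemma fN_single_seller:
  assumes "j \<in> {1..ms M}" "F \<subseteq> Esel E j"
  shows "f F = fext M j F"
proof -
  have "fext M k (F \<inter> Esel E k) = (if k = j then fext M j F else 0)" if "k \<in> {1..ms M}" for k
  proof (cases "k = j")
    case False
    then have "F \<inter> Esel E k = {}" using assms(2) by (auto simp: Esel_def)
    then show ?thesis using False fext_empty[OF that] by simp
  qed (use assms(2) in \<open>simp add: Int_absorb2\<close>)
  then have "f F = (\<Sum>k\<in>{1..ms M}. if k = j then fext M j F else 0)"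
    unfolding fN_def by (rule sum.cong[OF refl])
  then show ?thesis using assms(1) by simp
qed

lemma nonneg_on_iff: "nonneg_on A y \<longleftrightarrow> (\<forall>e. 0 \<le> y e) \<and> (\<forall>e. e \<notin> A \<longrightarrow> y e = 0)"
  unfolding nonneg_on_def by (metis order_refl)

lemma inP_iff: "inP M w \<longleftrightarrow> w \<in> polymatroid E f"
proof
  assume w: "inP M w"
  show "w \<in> polymatroid E f"
  proof (rule polymatroidI)
    fix F assume F: "F \<subseteq> E"
    have "F = (\<Union>j\<in>{1..ms M}. F \<inter> Esel E j)"
      using F E0_sub by (fastforce simp: Esel_def Emod_def)
    moreover have "(F \<inter> Esel E j) \<inter> (F \<inter> Esel E k) = {}" if "j \<noteq> k" for j k
      using that by (auto simp: Esel_def)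
    ultimately have "sum w F = (\<Sum>j\<in>{1..ms M}. sum w (F \<inter> Esel E j))"
      using sum.UNION_disjoint[of "{1..ms M}" "\<lambda>j. F \<inter> Esel E j" w] F by simp
    also have "\<dots> \<le> f F"
      unfolding fN_def using w by (intro sum_mono) (simp add: inP_def)
    finally show "sum w F \<le> f F" .
  qed (use w in \<open>auto simp: inP_def nonneg_on_iff\<close>)
next
  assume w: "w \<in> polymatroid E f"
  have "sum w F \<le> fext M j F" if j: "j \<in> {1..ms M}" "F \<subseteq> Esel E j" for j F
  proof -
    have "sum w F \<le> f F"
      using j(2) by (intro polymatroid_sum_le[OF w]) (auto simp: Esel_def)
    then show ?thesis by (simp only: fN_single_seller[OF j])
  qed
  then show "inP M w"
    using w by (simp add: inP_def nonneg_on_iff polymatroid_nonneg polymatroid_outside)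
qed

section \<open>The greedy vector and optimal liquid welfare\<close>

definition level :: "real \<Rightarrow> nat set" where
  "level \<theta> = {k \<in> N. \<theta> \<le> v k}"

lemma level_subset: "level \<theta> \<subseteq> N"
  by (auto simp: level_def)

definition affordable :: "nat \<Rightarrow> ereal" where
  "affordable k = B k / ereal (v k)"

definition budget_rank :: "nat set \<Rightarrow> real" where
  "budget_rank = rank f affordable"

abbreviation budget_feasible :: "(nat \<Rightarrow> real) \<Rightarrow> bool" where
  "budget_feasible x \<equiv> x \<in> polymatroid N budget_rank"

lemma le_affordable_iff:
  assumes "k \<in> N"
  shows "ereal t \<le> affordable k \<longleftrightarrow> ereal (v k * t) \<le> B k"
  using vm_pos[OF assms]
  by (cases rule: budget_cases[OF assms]) (auto simp: affordable_def field_simps)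

sublocale budget: capped_polymatroid E N fst f affordable
proof
  show "0 \<le> affordable k" if "k \<in> N" for k
    using le_affordable_iff[OF that, of 0]
    by (cases rule: budget_cases[OF that]) (auto simp: zero_ereal_def)
qed (simp_all add: submodular_on_fN fN_empty fN_nonneg)

lemma order_list: "set (order_list M) = N" "distinct (order_list M)"
  "sorted (map (\<lambda>i. (- v i, i)) (order_list M))"
  by (auto simp: order_list_def allN_def)

lemma Hset_prefix:
  assumes "order_list M = L1 @ i # L2"
  shows "Hset M i = set L1"
proof -
  have before: "(- v k, k) \<le> (- v i, i)" if "k \<in> set L1" for k
    using order_list(3) that unfolding assms by (auto simp: sorted_append)
  have after: "(- v i, i) \<le> (- v k, k)" if "k \<in> set L2" for k
    using order_list(3) that unfolding assms by (auto simp: sorted_append)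
  have split: "i \<notin> set L1" "set L1 \<union> insert i (set L2) = N"
    using order_list(1,2) unfolding assms by auto
  show ?thesis
  proof (intro equalityI subsetI)
    fix k assume "k \<in> Hset M i"
    then have "k \<in> N" "\<not> (- v i, i) \<le> (- v k, k)"
      by (auto simp: Hset_def less_eq_prod_def)
    then have "k \<in> N" "k \<notin> set L2" "k \<noteq> i"
      using after by blast+
    then show "k \<in> set L1" using split(2) by blast
  next
    fix k assume k: "k \<in> set L1"
    then have "k \<in> N" "k \<noteq> i" using split by auto
    then show "k \<in> Hset M i"
      using before[OF k] by (auto simp: Hset_def less_eq_prod_def)
  qed
qed

definition greedy_upto :: "nat set \<Rightarrow> (nat \<Rightarrow> real) \<Rightarrow> bool" where
  "greedy_upto S x \<longleftrightarrow> x \<in> polymatroid S budget_rank \<and>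
     (\<forall>U\<subseteq>S. (\<forall>k\<in>U. Hset M k \<subseteq> U) \<longrightarrow> sum x U = budget_rank U)"

lemma xstar_step_eq_marginal:
  assumes "x \<in> polymatroid (Hset M i) budget_rank" "sum x (Hset M i) = budget_rank (Hset M i)"
    and "i \<in> N"
  shows "xstar_step M x i = x(i := budget_rank (insert i (Hset M i)) - budget_rank (Hset M i))"
proof -
  have "Hset M i \<subseteq> N" "i \<in> N - Hset M i" "mono_on (Pow E) f"
    using assms(3) fN_mono by (auto simp: Hset_def intro: mono_onI)
  then have marginal: "ereal (budget_rank (insert i (Hset M i)) - budget_rank (Hset M i)) =
      min (affordable i) (ereal (Min {f (edges (insert i H)) - sum x H | H. H \<subseteq> Hset M i}))"
    using assms(1,2) unfolding budget_rank_def by (intro budget.rank_marginal)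
  have "xstar_step M x i =
      x(i := real_of_ereal (ereal (budget_rank (insert i (Hset M i)) - budget_rank (Hset M i))))"
    unfolding marginal by (simp add: xstar_step_def Ebuys_eq_edges affordable_def)
  then show ?thesis by simp
qed

lemma greedy_upto_step:
  assumes x: "greedy_upto S x" and i: "i \<in> N" "Hset M i = S"
  shows "greedy_upto (insert i S) (xstar_step M x i)"
proof -
  define z where "z = xstar_step M x i"
  have S: "S \<subseteq> N" "i \<notin> S" "\<And>k. k \<in> S \<Longrightarrow> Hset M k \<subseteq> S"
    using i(2) by (auto simp: Hset_def)
  have base: "x \<in> polymatroid S budget_rank" "sum x S = budget_rank S"
    using x S(3) by (auto simp: greedy_upto_def)
  have z: "z = x(i := budget_rank (insert i S) - budget_rank S)"
    unfolding z_def using xstar_step_eq_marginal[of x i] base i by simp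
  have rank: "submodular_on (insert i S) budget_rank" "mono_on (Pow (insert i S)) budget_rank"
    unfolding budget_rank_def using S(1) i(1)
    by (auto intro: submodular_on_subset[OF budget.submodular_on_rank]
        mono_on_subset[OF budget.mono_on_rank])
  have z_base: "z \<in> polymatroid (insert i S) budget_rank"
    "sum z (insert i S) = budget_rank (insert i S)"
    unfolding z using polymatroid_base_insert[OF _ S(2) rank base] S(1) by auto
  moreover have "sum z U = budget_rank U" if U: "U \<subseteq> insert i S" "\<forall>k\<in>U. Hset M k \<subseteq> U" for U
  proof (cases "i \<in> U")
    case True
    then have "U = insert i S" using U i(2) by blast
    then show ?thesis using z_base(2) by simp
  next
    case False
    then have "sum z U = sum x U"
      unfolding z by (intro sum.cong) auto
    then show ?thesis
      using x U False unfolding greedy_upto_def by (simp add: subset_insert)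
  qed
  ultimately show ?thesis
    unfolding greedy_upto_def z_def by blast
qed

lemma greedy_upto_prefix:
  "order_list M = L1 @ L2 \<Longrightarrow> greedy_upto (set L1) (foldl (xstar_step M) (\<lambda>_. 0) L1)"
proof (induction L1 arbitrary: L2 rule: rev_induct)
  case Nil
  then show ?case
    using budget.rank_empty by (auto simp: greedy_upto_def budget_rank_def intro: polymatroidI)
next
  case (snoc i L1)
  then have "order_list M = L1 @ i # L2" by simp
  moreover from this have "i \<in> N" using order_list(1) by auto
  ultimately show ?case
    using greedy_upto_step[OF snoc.IH _ Hset_prefix] by simp
qed

lemma greedy_upto_xstar: "greedy_upto N (xstar M)"
  using greedy_upto_prefix[of "order_list M" "[]"] order_list(1) by (simp add: xstar_def)

lemma budget_feasible_xstar: "budget_feasible (xstar M)"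
  using greedy_upto_xstar by (simp add: greedy_upto_def)

lemma sum_xstar_level: "sum (xstar M) (level \<theta>) = budget_rank (level \<theta>)"
proof -
  have "Hset M k \<subseteq> level \<theta>" if "k \<in> level \<theta>" for k
    using that by (auto simp: level_def Hset_def)
  then show ?thesis
    using greedy_upto_xstar level_subset[of \<theta>] by (simp add: greedy_upto_def)
qed

lemma welfare_le_xstar:
  assumes "budget_feasible x"
  shows "(\<Sum>i\<in>N. v i * x i) \<le> (\<Sum>i\<in>N. v i * xstar M i)"
proof (rule sum_mult_mono_level_sets[OF finite_N])
  show "sum x {i \<in> N. \<theta> \<le> v i} \<le> sum (xstar M) {i \<in> N. \<theta> \<le> v i}" for \<theta>
    using polymatroid_sum_le[OF assms level_subset] sum_xstar_level by (simp add: level_def)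
qed (use vm_pos in \<open>simp add: less_imp_le\<close>)

lemma LW_load_within_budget:
  assumes "\<And>i. i \<in> N \<Longrightarrow> ereal (v i * load w i) \<le> B i"
  shows "LW M w = ereal (\<Sum>i\<in>N. v i * load w i)"
proof -
  have "LW M w = (\<Sum>i\<in>N. ereal (v i * load w i))"
    unfolding LW_def sum_Ebuy using assms by (intro sum.cong) (auto simp: min_absorb1)
  then show ?thesis by simp
qed

lemma capped_load:
  assumes "i \<in> N" "0 \<le> a" and x: "x = real_of_ereal (min (ereal a) (affordable i))"
  shows "0 \<le> x" "x \<le> a" "ereal x \<le> affordable i" "min (ereal (v i * a)) (B i) = ereal (v i * x)"
  using assms(2) vm_pos[OF assms(1)] unfolding x
  by (cases rule: budget_cases[OF assms(1)]; auto simp: affordable_def min_def field_simps)+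

lemma LW_eq_budget_feasible_welfare:
  assumes "inP M w"
  shows "\<exists>x. budget_feasible x \<and> LW M w = ereal (\<Sum>i\<in>N. v i * x i)"
proof -
  define x where
    "x i = (if i \<in> N then real_of_ereal (min (ereal (load w i)) (affordable i)) else 0)" for i
  have w: "w \<in> polymatroid E f"
    using assms by (simp add: inP_iff)
  note x = capped_load[OF _ load_nonneg[OF polymatroid_nonneg[OF w]]]
  have "budget_feasible x"
    unfolding budget_rank_def
  proof (rule budget.polymatroid_rankI)
    show "hall_condition fst N E f x"
      using hall_condition_load[OF w] by (rule hall_condition_mono) (simp add: x_def x(2))
  qed (auto simp: x_def x(1,3))
  moreover have "LW M w = (\<Sum>i\<in>N. ereal (v i * x i))"
    unfolding LW_def sum_Ebuy by (intro sum.cong) (simp_all add: x_def x(4))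
  ultimately show ?thesis by (intro exI[of _ x]) simp
qed

lemma LW_OPT_xstar: "LW_OPT M = ereal (\<Sum>i\<in>N. v i * xstar M i)"
proof (rule antisym)
  show "LW_OPT M \<le> ereal (\<Sum>i\<in>N. v i * xstar M i)"
    unfolding LW_OPT_def
  proof (rule SUP_least)
    fix w assume "w \<in> {w. inP M w}"
    then obtain x where "budget_feasible x" "LW M w = ereal (\<Sum>i\<in>N. v i * x i)"
      using LW_eq_budget_feasible_welfare by blast
    then show "LW M w \<le> ereal (\<Sum>i\<in>N. v i * xstar M i)"
      using welfare_le_xstar by simp
  qed
  obtain w where w: "w \<in> feasible f affordable" "load w = xstar M"
    using budget.feasible_with_load budget_feasible_xstar unfolding budget_rank_def by blast
  then have "LW M w = ereal (\<Sum>i\<in>N. v i * xstar M i)" "inP M w"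
    using LW_load_within_budget[of w] le_affordable_iff by (auto simp: feasible_def inP_iff)
  then show "ereal (\<Sum>i\<in>N. v i * xstar M i) \<le> LW_OPT M"
    unfolding LW_OPT_def by (metis SUP_upper mem_Collect_eq)
qed

end

section \<open>Runs of the auction\<close>

context market_model
begin

definition residual :: "(edge \<Rightarrow> real) \<Rightarrow> edge set \<Rightarrow> real" where
  "residual w = (\<lambda>F. f F - sum w F)"

definition alloc :: "pca_state \<Rightarrow> nat \<Rightarrow> real" where
  "alloc s = load (wS s)"

definition remaining :: "pca_state \<Rightarrow> nat set \<Rightarrow> real" where
  "remaining s = rank (residual (wS s)) (dS s)"

definition potential :: "pca_state \<Rightarrow> nat set \<Rightarrow> real" where
  "potential s S = sum (alloc s) S + remaining s S"

definition redundant :: "pca_state \<Rightarrow> nat \<Rightarrow> bool" where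
  "redundant s k \<longleftrightarrow> remaining s N \<le> remaining s (N - {k})"

definition consistent :: "pca_state \<Rightarrow> bool" where
  "consistent s \<longleftrightarrow> inP M (wS s) \<and> dS s = dem M v (cS s) (pS s) \<and>
     (\<forall>k\<in>N. 0 \<le> cS s k \<and> ereal (pS s k) \<le> B k \<and> pS s k \<le> cS s k * alloc s k)"

lemma consistentI:
  assumes "inP M (wS s)" "dS s = dem M v (cS s) (pS s)"
    "\<And>k. k \<in> N \<Longrightarrow> 0 \<le> cS s k" "\<And>k. k \<in> N \<Longrightarrow> ereal (pS s k) \<le> B k"
    "\<And>k. k \<in> N \<Longrightarrow> pS s k \<le> cS s k * alloc s k"
  shows "consistent s"
  using assms by (simp add: consistent_def)

lemma consistentD:
  assumes "consistent s"
  shows "inP M (wS s)" "dS s = dem M v (cS s) (pS s)"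
    "\<And>k. k \<in> N \<Longrightarrow> 0 \<le> cS s k" "\<And>k. k \<in> N \<Longrightarrow> ereal (pS s k) \<le> B k"
    "\<And>k. k \<in> N \<Longrightarrow> pS s k \<le> cS s k * alloc s k"
  using assms by (auto simp: consistent_def)

lemma alloc_nonneg: "consistent s \<Longrightarrow> 0 \<le> alloc s k"
  unfolding alloc_def using consistentD(1)
  by (auto simp: inP_iff intro: load_nonneg polymatroid_nonneg)

lemma dem_nonneg:
  assumes "k \<in> N" "0 \<le> c k" "ereal (p k) \<le> B k"
  shows "0 \<le> dem M b c p k"
  using assms(2,3) by (cases rule: budget_cases[OF assms(1)]) (auto simp: dem_def)

lemma capped_polymatroid_state:
  assumes "consistent s"
  shows "capped_polymatroid E N fst (residual (wS s)) (dS s)"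
proof
  show "submodular_on E (residual (wS s))"
    unfolding residual_def using finite_E submodular_on_fN by (rule submodular_on_diff_sum)
  show "0 \<le> residual (wS s) F" if "F \<subseteq> E" for F
    using consistentD(1)[OF assms] that by (simp add: inP_iff residual_def polymatroid_sum_le)
  show "0 \<le> dS s k" if "k \<in> N" for k
    using consistentD(2-4)[OF assms] that by (simp add: dem_nonneg)
qed (simp add: residual_def fN_empty)

lemma remaining_mono: "consistent s \<Longrightarrow> S \<subseteq> T \<Longrightarrow> T \<subseteq> N \<Longrightarrow> remaining s S \<le> remaining s T"
  unfolding remaining_def
  using capped_polymatroid.mono_on_rank[OF capped_polymatroid_state] by (auto intro: mono_onD)

lemma Pwd_eq_feasible:
  assumes "inP M w"
  shows "Pwd M w d = feasible (residual w) d"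
proof -
  have "inP M (\<lambda>e. w e + y e) \<longleftrightarrow> (\<forall>F\<subseteq>E. sum y F \<le> residual w F)" if "nonneg_on E y" for y
    using assms that unfolding inP_iff polymatroid_def residual_def nonneg_on_iff
    by (auto simp: sum.distrib le_diff_eq add.commute)
  then show ?thesis
    unfolding Pwd_def feasible_def polymatroid_def sum_Ebuy by (auto simp: nonneg_on_iff)
qed

lemma Pproj_eq_projections: "inP M w \<Longrightarrow> Pproj M w d i xi = projections (residual w) d i xi"
  unfolding Pproj_def projections_def Pwd_eq_feasible sum_Ebuy unfolding Ebuy_eq_edges by blast

lemma clinchable_iff_clinch_vector:
  assumes "consistent s" "i \<in> N"
  shows "clinchable M (wS s) (dS s) i xi \<longleftrightarrow> clinch_vector (residual (wS s)) (dS s) i xi"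
proof -
  have "nonneg_on (Ebuy E i) xi \<longleftrightarrow> supported_by i xi"
    by (simp add: nonneg_on_iff supported_by_def Ebuy_eq_edges)
  then show ?thesis
    unfolding clinchable_def Pproj_eq_projections[OF consistentD(1)[OF assms(1)]]
    using clinch_vectorD(1) capped_polymatroid.clinch_vector_iff_projections[OF
        capped_polymatroid_state[OF assms(1)] _ assms(2)]
    by metis
qed

lemma dem_after_payment:
  assumes "k \<in> N" "0 \<le> c k" "0 \<le> a" "ereal a \<le> dem M v c p k"
  shows "dem M v c (p(k := p k + c k * a)) = (dem M v c p)(k := dem M v c p k - ereal a)"
proof -
  have "dem M v c (p(k := p k + c k * a)) k = dem M v c p k - ereal a"
  proof (cases "c k = 0 \<or> v k \<le> c k")
    case True
    then show ?thesis
      using assms(3,4) vm_pos[OF assms(1)] by (auto simp: dem_def zero_ereal_def)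
  next
    case False
    then show ?thesis
      using assms(2) by (cases rule: budget_cases[OF assms(1)]) (auto simp: dem_def field_simps)
  qed
  moreover have "dem M v c (p(k := p k + c k * a)) j = dem M v c p j" if "j \<noteq> k" for j
    using that by (simp add: dem_def)
  ultimately show ?thesis
    by (auto simp: fun_eq_iff)
qed

lemma payment_within_budget:
  assumes "k \<in> N" "0 \<le> c k" "0 \<le> a" "ereal a \<le> dem M v c p k" "ereal (p k) \<le> B k"
  shows "ereal (p k + c k * a) \<le> B k"
proof (cases "c k = 0 \<or> v k \<le> c k")
  case True
  then have "c k * a = 0"
    using assms(3,4) vm_pos[OF assms(1)] by (auto simp: dem_def zero_ereal_def)
  then show ?thesis using assms(5) by (simp only: add_0_right)
next
  case False
  then show ?thesis
    using assms(2,4) by (cases rule: budget_cases[OF assms(1)]) (auto simp: dem_def field_simps)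
qed

end

locale clinch_step = market_model M +
  clinching "Emod M" "allN M" fst "market_model.residual M (wS s)" "dS s" i xi
  for M and s s' :: pca_state and i xi +
  assumes consistent_pre: "consistent s"
    and maximal: "\<And>xi'. clinch_vector (residual (wS s)) (dS s) i xi' \<Longrightarrow> \<forall>e. xi e \<le> xi' e \<Longrightarrow> xi' = xi"
    and state_post: "s' = s\<lparr>wS := (\<lambda>e. wS s e + xi e),
      pS := (pS s)(i := pS s i + cS s i * load xi i),
      dS := (dS s)(i := dS s i - ereal (load xi i))\<rparr>"
begin

lemma clocks_unchanged: "cS s' = cS s" "lS s' = lS s"
  by (simp_all add: state_post)

lemma load_xi_nonneg: "0 \<le> load xi i"
  using supported_by_nonneg[OF xi_supported] by (rule load_nonneg)

lemma load_le_dem: "ereal (load xi i) \<le> dem M v (cS s) (pS s) i"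
  using load_le_cap consistentD(2)[OF consistent_pre] by simp

lemma alloc_post: "alloc s' k = alloc s k + (if k = i then load xi i else 0)"
  using load_supported_by[OF xi_supported, of k] by (simp add: alloc_def state_post load_add)

lemma remaining_post: "remaining s' = post.rk"
  by (simp add: remaining_def state_post residual_def sum.distrib diff_diff_eq)

lemma consistent_post: "consistent s'"
proof (rule consistentI)
  show "inP M (wS s')"
    unfolding inP_iff
  proof (rule polymatroidI)
    show "sum (wS s') F \<le> f F" if "F \<subseteq> E" for F
      using post.g_nonneg[OF that] by (simp add: state_post residual_def sum.distrib)
  qed (use consistentD(1)[OF consistent_pre] xi_supported in
      \<open>auto simp: state_post inP_iff polymatroid_def supported_by_def edges_def\<close>)
  show "dS s' = dem M v (cS s') (pS s')"
    using dem_after_payment[of i "cS s" "load xi i" "pS s"] load_le_dem load_xi_nonneg i_in_N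
      consistentD(2,3)[OF consistent_pre] by (simp add: state_post)
  fix k assume k: "k \<in> N"
  show "0 \<le> cS s' k"
    using consistentD(3)[OF consistent_pre k] by (simp add: state_post)
  show "ereal (pS s' k) \<le> B k"
    using payment_within_budget[of i "cS s" "load xi i" "pS s"] load_le_dem load_xi_nonneg
      consistentD(3,4)[OF consistent_pre] k i_in_N by (simp add: state_post)
  show "pS s' k \<le> cS s' k * alloc s' k"
    using consistentD(5)[OF consistent_pre k] alloc_post[of k]
    by (auto simp: state_post algebra_simps)
qed

lemma potential_mono:
  assumes "S \<subseteq> N"
  shows "potential s S \<le> potential s' S"
proof -
  have "sum (alloc s') S = sum (alloc s) S + (if i \<in> S then load xi i else 0)"
    using assms by (simp add: alloc_post sum.distrib)
  then show ?thesis
    using rank_post_ge[OF assms] unfolding potential_def remaining_post by (simp add: remaining_def)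
qed

lemma redundant_clinched: "redundant s' i"
  unfolding redundant_def remaining_post using maximal by (rule maximal_clinch_rank_remove)

lemma redundant_preserved:
  assumes "redundant s k"
  shows "redundant s' k"
proof (cases "k = i")
  case False
  then have "rk (N - {k}) - load xi i \<le> post.rk (N - {k})"
    using rank_post_ge[of "N - {k}"] i_in_N by auto
  then show ?thesis
    using rank_post_le[OF order_refl i_in_N] assms unfolding redundant_def remaining_post
    by (simp add: remaining_def)
qed (simp add: redundant_clinched)

lemma alloc_dropped:
  assumes "k \<in> N" "v k \<le> cS s k"
  shows "alloc s' k = alloc s k"
  using assms load_le_dem load_xi_nonneg vm_pos[OF assms(1)]
  by (auto simp: alloc_post dem_def zero_ereal_def)

end

context market_model
begin

lemma clinch_one_clinch_step:
  assumes "consistent s" "i \<in> N" "clinch_one M v i s s'"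
  obtains xi where "clinch_step M s s' i xi"
proof -
  obtain xi where max: "max_clinchable M (wS s) (dS s) i xi"
    and s': "s' = s\<lparr>wS := (\<lambda>e. wS s e + xi e), pS := (pS s)(i := pS s i + cS s i * load xi i),
        dS := dem M v (cS s) ((pS s)(i := pS s i + cS s i * load xi i))\<rparr>"
    using assms(3) by (auto simp: clinch_one_def Let_def sum_Ebuy)
  note clinchable = clinchable_iff_clinch_vector[OF assms(1,2)]
  interpret capped_polymatroid E N fst "residual (wS s)" "dS s"
    using assms(1) by (rule capped_polymatroid_state)
  have "clinch_vector (residual (wS s)) (dS s) i xi"
    using max clinchable by (simp add: max_clinchable_def)
  then interpret clinching E N fst "residual (wS s)" "dS s" i xi
    using assms(2) by unfold_locales
  have "xi' = xi" if "clinch_vector (residual (wS s)) (dS s) i xi'" "\<forall>e. xi e \<le> xi' e" for xi'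
    using max that clinchable unfolding max_clinchable_def by blast
  moreover have "dem M v (cS s) ((pS s)(i := pS s i + cS s i * load xi i)) =
      (dS s)(i := dS s i - ereal (load xi i))"
    using dem_after_payment[of i "cS s" "load xi i" "pS s"] load_le_cap
      consistentD(2,3)[OF assms(1)] assms(2) load_nonneg[OF supported_by_nonneg[OF xi_supported]]
    by simp
  ultimately have "clinch_step M s s' i xi"
    using assms(1) s' by unfold_locales auto
  then show thesis by (rule that)
qed

lemma clinch_list_invariant:
  assumes "clinch_list M v is s s'" "set is \<subseteq> N" "consistent s" "P s"
    and step: "\<And>i s s' xi. clinch_step M s s' i xi \<Longrightarrow> P s \<Longrightarrow> P s'"
  shows "consistent s' \<and> P s'"
  using assms(1-4)
proof (induction rule: clinch_list.induct)
  case (Cons i s s1 "is" s2)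
  obtain xi where "clinch_step M s s1 i xi"
    using clinch_one_clinch_step[OF Cons.prems(2) _ Cons.hyps(1)] Cons.prems(1) by auto
  then have "consistent s1" "P s1"
    using clinch_step.consistent_post step Cons.prems(3) by blast+
  then show ?case using Cons.IH Cons.prems(1) by simp
qed simp

lemma clinch_list_consistent: "clinch_list M v is s s' \<Longrightarrow> set is \<subseteq> N \<Longrightarrow> consistent s \<Longrightarrow> consistent s'"
  using clinch_list_invariant[of "is" s s' "\<lambda>_. True"] by simp

lemma clinch_list_clocks:
  assumes "clinch_list M v is s s'" "set is \<subseteq> N" "consistent s"
  shows "cS s' = cS s" "lS s' = lS s"
  using clinch_list_invariant[OF assms, of "\<lambda>t. cS t = cS s \<and> lS t = lS s"]
  by (simp_all add: clinch_step.clocks_unchanged)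

lemma clinch_list_potential_mono:
  assumes "clinch_list M v is s s'" "set is \<subseteq> N" "consistent s" "S \<subseteq> N"
  shows "potential s S \<le> potential s' S"
  using clinch_list_invariant[OF assms(1-3), of "\<lambda>t. potential s S \<le> potential t S"]
    clinch_step.potential_mono[OF _ assms(4)] order_trans by blast

lemma clinch_list_alloc_dropped:
  assumes "clinch_list M v is s s'" "set is \<subseteq> N" "consistent s" "k \<in> N" "v k \<le> cS s k"
  shows "alloc s' k = alloc s k"
  using assms(4,5) clinch_list_invariant[OF assms(1-3), of "\<lambda>t. cS t = cS s \<and> alloc t k = alloc s k"]
  by (simp add: clinch_step.clocks_unchanged clinch_step.alloc_dropped)

lemma clinch_list_redundant:
  assumes "clinch_list M v is s s'" "set is \<subseteq> N" "consistent s" "k \<in> set is"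
  shows "redundant s' k"
  using assms
proof (induction rule: clinch_list.induct)
  case (Cons i s s1 "is" s2)
  obtain xi where step: "clinch_step M s s1 i xi"
    using clinch_one_clinch_step[OF Cons.prems(2) _ Cons.hyps(1)] Cons.prems(1) by auto
  then have consistent: "consistent s1" by (rule clinch_step.consistent_post)
  show ?case
  proof (cases "k = i")
    case True
    then have "redundant s1 k" using step by (simp add: clinch_step.redundant_clinched)
    then show ?thesis
      using Cons.prems(1) clinch_list_invariant[OF Cons.hyps(2) _ consistent, of "\<lambda>t. redundant t k"]
        clinch_step.redundant_preserved by auto
  qed (use Cons.IH consistent Cons.prems in auto)
qed simp

end

locale auction_model = market_model +
  fixes eps :: real
  assumes eps_pos: "0 < eps"
    and bids_grid: "\<forall>i\<in>allN M. \<exists>k::nat. 0 < k \<and> vm M i = real k * eps"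
begin

definition active :: "pca_state \<Rightarrow> nat set" where
  "active s = {k \<in> N. cS s k < v k}"

definition cyclic_clocks :: "pca_state \<Rightarrow> bool" where
  "cyclic_clocks s \<longleftrightarrow> (N \<noteq> {} \<longrightarrow> lS s \<in> N) \<and>
     (\<exists>A::nat. \<forall>k\<in>N. cS s k = real (if k < lS s then Suc A else A) * eps)"

definition raise_price :: "pca_state \<Rightarrow> pca_state" where
  "raise_price s = (let c = (cS s)(lS s := cS s (lS s) + eps) in
     s\<lparr>cS := c, dS := (dS s)(lS s := dem M v c (pS s) (lS s)), lS := lS s mod (nb M + ms M) + 1\<rparr>)"

lemma raise_price_simps [simp]:
  "wS (raise_price s) = wS s" "pS (raise_price s) = pS s"
  "cS (raise_price s) = (cS s)(lS s := cS s (lS s) + eps)"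
  "dS (raise_price s) = (dS s)(lS s := dem M v ((cS s)(lS s := cS s (lS s) + eps)) (pS s) (lS s))"
  "lS (raise_price s) = lS s mod (nb M + ms M) + 1"
  by (simp_all add: raise_price_def Let_def)

lemma alloc_raise_price [simp]: "alloc (raise_price s) = alloc s"
  by (simp add: alloc_def)

lemma pca_iterE:
  assumes "pca_iter M eps v s s'"
  obtains t where "clinch_list M v [1..<nb M + ms M + 1] s t" "s' = raise_price t" "N \<noteq> {}"
  using assms that unfolding pca_iter_def raise_price_def Let_def by blast

lemma set_buyers: "set [1..<nb M + ms M + 1] = N"
  by (auto simp: allN_def)

lemma active_subset: "active s \<subseteq> N"
  by (auto simp: active_def)

lemma price_plus_eps_le:
  assumes "cyclic_clocks s" "l \<in> active s"
  shows "cS s l + eps \<le> v l"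
proof -
  obtain A :: nat where A: "cS s l = real A * eps"
    using assms unfolding cyclic_clocks_def active_def by blast
  obtain K :: nat where K: "v l = real K * eps"
    using bids_grid assms(2) by (auto simp: active_def)
  have "A < K"
    using assms(2) eps_pos by (simp add: active_def A K)
  then have "real (Suc A) * eps \<le> real K * eps"
    using eps_pos by (intro mult_right_mono) auto
  then show ?thesis by (simp add: A K algebra_simps)
qed

lemma clock_spread:
  assumes "cyclic_clocks s" "k \<in> N" "l \<in> N"
  shows "cS s k \<le> cS s l + eps"
proof -
  obtain A :: nat where "\<forall>k\<in>N. cS s k = real (if k < lS s then Suc A else A) * eps"
    using assms(1) unfolding cyclic_clocks_def by blast
  then show ?thesis
    using assms(2,3) eps_pos by (auto simp: algebra_simps)
qed

lemma level_active_dichotomy: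
  assumes "cyclic_clocks s"
  shows "active s \<subseteq> level \<theta> \<or> level \<theta> \<subseteq> active s"
proof (rule disjCI)
  assume "\<not> level \<theta> \<subseteq> active s"
  then obtain k where k: "k \<in> N" "\<theta> \<le> v k" "v k \<le> cS s k"
    by (force simp: active_def level_def)
  show "active s \<subseteq> level \<theta>"
  proof
    fix l assume l: "l \<in> active s"
    then have "\<theta> \<le> v l"
      using clock_spread[OF assms k(1), of l] price_plus_eps_le[OF assms l] k
      by (simp add: active_def)
    then show "l \<in> level \<theta>" using l by (simp add: active_def level_def)
  qed
qed

lemma active_raise_price:
  "active s - {lS s} \<subseteq> active (raise_price s)" "active (raise_price s) \<subseteq> active s"
  using eps_pos by (auto simp: active_def split: if_splits)

lemma remaining_raise_price_other: "lS s \<notin> S \<Longrightarrow> remaining (raise_price s) S = remaining s S"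
  unfolding remaining_def by (auto intro: rank_cong)

lemma consistent_raise_price:
  assumes "consistent s"
  shows "consistent (raise_price s)"
proof (rule consistentI)
  show "dS (raise_price s) = dem M v (cS (raise_price s)) (pS (raise_price s))"
    using consistentD(2)[OF assms] by (auto simp: dem_def fun_eq_iff)
  fix k assume k: "k \<in> N"
  have c_le: "cS s k \<le> cS (raise_price s) k" using eps_pos by simp
  then show "0 \<le> cS (raise_price s) k"
    using consistentD(3)[OF assms k] by linarith
  have "pS s k \<le> cS s k * alloc s k"
    using consistentD(5)[OF assms k] .
  also have "\<dots> \<le> cS (raise_price s) k * alloc s k"
    using c_le alloc_nonneg[OF assms] by (rule mult_right_mono)
  finally show "pS (raise_price s) k \<le> cS (raise_price s) k * alloc (raise_price s) k"
    by simp
qed (use consistentD(1,4)[OF assms] in simp_all)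

lemma cyclic_clocks_raise_price:
  assumes "cyclic_clocks s" "N \<noteq> {}"
  shows "cyclic_clocks (raise_price s)"
proof -
  define l where "l = lS s"
  have l: "l \<in> N"
    using assms by (simp add: cyclic_clocks_def l_def)
  obtain A :: nat where A: "\<forall>k\<in>N. cS s k = real (if k < l then Suc A else A) * eps"
    using assms(1) unfolding cyclic_clocks_def l_def by blast
  have c: "cS (raise_price s) k = real (if k \<le> l then Suc A else A) * eps" if "k \<in> N" for k
    using A that l by (cases "k = l") (auto simp: algebra_simps simp flip: l_def)
  show ?thesis
  proof (cases "l = nb M + ms M")
    case True
    then have "lS (raise_price s) = 1" by (simp flip: l_def)
    moreover have "cS (raise_price s) k = real (Suc A) * eps" if "k \<in> N" for k
      using c[OF that] that True by (simp add: allN_def)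
    ultimately show ?thesis
      unfolding cyclic_clocks_def using l by (auto intro!: exI[of _ "Suc A"] simp: allN_def)
  next
    case False
    then have "lS (raise_price s) = Suc l" "Suc l \<in> N"
      using l by (auto simp: allN_def simp flip: l_def)
    then show ?thesis
      unfolding cyclic_clocks_def using c by (auto simp: less_Suc_eq_le intro!: exI[of _ A])
  qed
qed

lemma remaining_N_raise_price:
  assumes "consistent s" "redundant s (lS s)"
  shows "remaining s N \<le> remaining (raise_price s) N"
proof -
  have "remaining s N \<le> remaining s (N - {lS s})"
    using assms(2) by (simp add: redundant_def)
  also have "\<dots> = remaining (raise_price s) (N - {lS s})"
    by (simp add: remaining_raise_price_other)
  also have "\<dots> \<le> remaining (raise_price s) N"
    using consistent_raise_price[OF assms(1)] by (rule remaining_mono) auto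
  finally show ?thesis .
qed

lemma affordable_le_alloc_add_demand:
  assumes "consistent s" "l \<in> N" "cS s l \<le> c" "0 < c" "c < v l"
  shows "affordable l \<le> ereal (alloc s l) + (B l - ereal (pS s l)) / ereal c"
  using assms(2)
proof (cases rule: budget_cases)
  case (finite r)
  have "pS s l \<le> cS s l * alloc s l"
    using consistentD(5)[OF assms(1,2)] .
  also have "\<dots> \<le> c * alloc s l"
    using assms(3) alloc_nonneg[OF assms(1)] by (rule mult_right_mono)
  finally have "r / c \<le> alloc s l + (r - pS s l) / c"
    using assms(4) by (simp add: field_simps)
  moreover have "r / v l \<le> r / c"
    using finite(2) assms(4,5) by (intro divide_left_mono) auto
  ultimately show ?thesis
    using finite(1) assms(4,5) by (simp add: affordable_def)
next
  case infinite
  then show ?thesis using assms(4) by simp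
qed

definition active_dominated :: "(nat \<Rightarrow> real) \<Rightarrow> pca_state \<Rightarrow> bool" where
  "active_dominated x s \<longleftrightarrow> (\<forall>T\<subseteq>active s. sum x T \<le> potential s T)"

definition level_dominated :: "(nat \<Rightarrow> real) \<Rightarrow> pca_state \<Rightarrow> bool" where
  "level_dominated x s \<longleftrightarrow>
     (\<forall>\<theta>. active s \<subseteq> level \<theta> \<longrightarrow> sum x (level \<theta>) \<le> sum (alloc s) (level \<theta>) + remaining s N)"

lemma active_dominated_clinch_list:
  assumes "clinch_list M v is s t" "set is \<subseteq> N" "consistent s" "active_dominated x s"
  shows "active_dominated x t"
proof -
  have "active t = active s"
    using clinch_list_clocks[OF assms(1-3)] by (simp add: active_def)
  moreover have "sum x T \<le> potential t T" if "T \<subseteq> active s" for T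
    using clinch_list_potential_mono[OF assms(1-3), of T] assms(4) that active_subset[of s]
    unfolding active_dominated_def by (meson order_trans)
  ultimately show ?thesis
    by (simp add: active_dominated_def)
qed

lemma level_dominated_clinch_list:
  assumes "clinch_list M v is s t" "set is \<subseteq> N" "consistent s" "level_dominated x s"
  shows "level_dominated x t"
  unfolding level_dominated_def
proof (intro allI impI)
  fix \<theta> assume "active t \<subseteq> level \<theta>"
  then have level: "active s \<subseteq> level \<theta>"
    using clinch_list_clocks[OF assms(1-3)] by (simp add: active_def)
  have "alloc t k = alloc s k" if "k \<in> N - level \<theta>" for k
    using that level by (intro clinch_list_alloc_dropped[OF assms(1-3)]) (auto simp: active_def)
  then have "sum (alloc t) (N - level \<theta>) = sum (alloc s) (N - level \<theta>)"
    by (rule sum.cong[OF refl])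
  moreover have "sum (alloc u) N = sum (alloc u) (N - level \<theta>) + sum (alloc u) (level \<theta>)" for u
    using level_subset finite_N by (rule sum.subset_diff)
  ultimately have "sum (alloc s) (level \<theta>) + remaining s N
      \<le> sum (alloc t) (level \<theta>) + remaining t N"
    using clinch_list_potential_mono[OF assms(1-3) order_refl] by (simp add: potential_def)
  then show "sum x (level \<theta>) \<le> sum (alloc t) (level \<theta>) + remaining t N"
    using assms(4) level unfolding level_dominated_def by (meson order_trans)
qed

lemma remaining_raise_price_cases:
  assumes "T \<subseteq> N" "lS s \<in> T"
  shows "remaining s T \<le> remaining (raise_price s) T \<or>
    dS (raise_price s) (lS s) \<noteq> \<infinity> \<and>
    remaining s (T - {lS s}) + real_of_ereal (dS (raise_price s) (lS s))
      \<le> remaining (raise_price s) T"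
proof -
  have "remaining (raise_price s) T =
      rank (residual (wS s)) ((dS s)(lS s := dS (raise_price s) (lS s))) T"
    unfolding remaining_def by simp
  then show ?thesis
    using rank_fun_upd_cases[OF assms] unfolding remaining_def by metis
qed

lemma budget_feasible_le_alloc_add_demand:
  assumes "budget_feasible x" "consistent s" "lS s \<in> active (raise_price s)"
    "dS (raise_price s) (lS s) \<noteq> \<infinity>"
  shows "x (lS s) \<le> alloc s (lS s) + real_of_ereal (dS (raise_price s) (lS s))"
proof -
  define l where "l = lS s"
  define c where "c = cS s l + eps"
  have l: "l \<in> N" "cS s l \<le> c" "0 < c" "c < v l"
    using assms(3) eps_pos consistentD(3)[OF assms(2), of l] by (auto simp: active_def c_def l_def)
  have "0 \<le> dS (raise_price s) l"
    using capped_polymatroid_state[OF consistent_raise_price[OF assms(2)]] l(1)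
    by (rule capped_polymatroid.D_nonneg)
  have "ereal (x l) \<le> affordable l"
    using assms(1) l(1) unfolding budget_rank_def by (rule budget.polymatroid_rank_cap)
  also have "\<dots> \<le> ereal (alloc s l) + (B l - ereal (pS s l)) / ereal c"
    using assms(2) l by (rule affordable_le_alloc_add_demand)
  also have "(B l - ereal (pS s l)) / ereal c = dS (raise_price s) l"
    using l(3,4) by (simp add: c_def l_def dem_def)
  finally show ?thesis
    using assms(4) \<open>0 \<le> dS (raise_price s) l\<close> unfolding l_def[symmetric]
    by (cases "dS (raise_price s) l") auto
qed

lemma active_dominated_raise_price:
  assumes x: "budget_feasible x" and s: "consistent s" "active_dominated x s"
  shows "active_dominated x (raise_price s)"
  unfolding active_dominated_def
proof (intro allI impI)
  fix T assume T: "T \<subseteq> active (raise_price s)"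
  then have TN: "T \<subseteq> N"
    using active_subset by blast
  have "T \<subseteq> active s"
    using T active_raise_price(2) by blast
  then have old: "sum x U \<le> potential s U" if "U \<subseteq> T" for U
    using s(2) that by (simp add: active_dominated_def)
  consider (other) "lS s \<notin> T" | (not_lowered) "lS s \<in> T" "remaining s T \<le> remaining (raise_price s) T"
    | (lowered) "lS s \<in> T" "dS (raise_price s) (lS s) \<noteq> \<infinity>"
      "remaining s (T - {lS s}) + real_of_ereal (dS (raise_price s) (lS s))
        \<le> remaining (raise_price s) T"
    using remaining_raise_price_cases[OF TN] by blast
  then show "sum x T \<le> potential (raise_price s) T"
  proof cases
    case lowered
    have "x (lS s) \<le> alloc s (lS s) + real_of_ereal (dS (raise_price s) (lS s))"
      using x s(1) _ lowered(2)
      by (rule budget_feasible_le_alloc_add_demand) (use T lowered(1) in blast)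
    moreover have "sum x (T - {lS s}) \<le> potential s (T - {lS s})"
      by (rule old) auto
    moreover have "sum x T = x (lS s) + sum x (T - {lS s})"
      "sum (alloc s) T = alloc s (lS s) + sum (alloc s) (T - {lS s})"
      using TN lowered(1) by (intro sum.remove; simp)+
    ultimately show ?thesis
      using lowered(3) unfolding potential_def alloc_raise_price by linarith
  qed (use old[of T] in \<open>simp_all add: potential_def remaining_raise_price_other\<close>)
qed

lemma level_dominated_raise_price:
  assumes s: "consistent s" "cyclic_clocks s" "redundant s (lS s)"
    and x: "active_dominated x s" "level_dominated x s"
  shows "level_dominated x (raise_price s)"
  unfolding level_dominated_def
proof (intro allI impI)
  fix \<theta> assume level: "active (raise_price s) \<subseteq> level \<theta>"
  show "sum x (level \<theta>) \<le> sum (alloc (raise_price s)) (level \<theta>) + remaining (raise_price s) N"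
  proof (cases "active s \<subseteq> level \<theta>")
    case True
    then show ?thesis
      using x(2) remaining_N_raise_price[OF s(1,3)] unfolding level_dominated_def by fastforce
  next
    case False
    then have "lS s \<notin> level \<theta>"
      using active_raise_price(1)[of s] level by blast
    have "level \<theta> \<subseteq> active s"
      using level_active_dichotomy[OF s(2)] False by blast
    then have "sum x (level \<theta>) \<le> potential s (level \<theta>)"
      using x(1) by (simp add: active_dominated_def)
    also have "\<dots> = sum (alloc s) (level \<theta>) + remaining (raise_price s) (level \<theta>)"
      using \<open>lS s \<notin> level \<theta>\<close> by (simp add: potential_def remaining_raise_price_other)
    also have "\<dots> \<le> sum (alloc s) (level \<theta>) + remaining (raise_price s) N"
      using remaining_mono[OF consistent_raise_price[OF s(1)] level_subset order_refl] by simp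
    finally show ?thesis by simp
  qed
qed

definition dominance_invariant :: "(nat \<Rightarrow> real) \<Rightarrow> pca_state \<Rightarrow> bool" where
  "dominance_invariant x s \<longleftrightarrow>
     consistent s \<and> cyclic_clocks s \<and> active_dominated x s \<and> level_dominated x s"

lemma dominance_invariant_iter:
  assumes x: "budget_feasible x" and s: "dominance_invariant x s" and "pca_iter M eps v s s'"
  shows "dominance_invariant x s'"
proof -
  obtain t where t: "clinch_list M v [1..<nb M + ms M + 1] s t"
    and s': "s' = raise_price t" and "N \<noteq> {}"
    using assms(3) by (rule pca_iterE)
  have s: "consistent s" "cyclic_clocks s" "active_dominated x s" "level_dominated x s"
    using s by (auto simp: dominance_invariant_def)
  note clinch = t equalityD1[OF set_buyers] s(1)
  have "consistent t" "active_dominated x t" "level_dominated x t"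
    using clinch_list_consistent[OF clinch] active_dominated_clinch_list[OF clinch s(3)]
      level_dominated_clinch_list[OF clinch s(4)] by auto
  moreover have "cyclic_clocks t"
    using s(2) clinch_list_clocks[OF clinch] by (simp add: cyclic_clocks_def)
  moreover from this have "redundant t (lS t)"
    using clinch_list_redundant[OF clinch] \<open>N \<noteq> {}\<close> unfolding set_buyers
    by (simp add: cyclic_clocks_def)
  ultimately show ?thesis
    unfolding dominance_invariant_def s' using x \<open>N \<noteq> {}\<close>
    by (simp add: consistent_raise_price cyclic_clocks_raise_price active_dominated_raise_price
        level_dominated_raise_price)
qed

lemma consistent_init: "consistent pca_init"
proof (rule consistentI)
  show "inP M (wS pca_init)"
    using fN_nonneg by (auto simp: inP_iff pca_init_def intro: polymatroidI)
  show "ereal (pS pca_init k) \<le> B k" if "k \<in> N" for k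
    by (cases rule: budget_cases[OF that]) (auto simp: pca_init_def)
qed (auto simp: pca_init_def dem_def)

lemma remaining_init_ge:
  assumes x: "budget_feasible x" and T: "T \<subseteq> N"
  shows "sum x T \<le> remaining pca_init T"
proof -
  obtain F H where opt: "dual_solution (dS pca_init) T F H"
    "remaining pca_init T = residual (wS pca_init) F + caps (dS pca_init) (T - H)"
    unfolding remaining_def using rank_attained[OF T] .
  then have "H = T"
    by (auto simp: dual_solution_def pca_init_def)
  then have "sum x T \<le> f F"
    using x opt(1) unfolding budget_rank_def
    by (intro hall_conditionD[OF budget.polymatroid_rank_hall T]) (simp_all add: dual_solution_def)
  then show ?thesis
    using opt(2) \<open>H = T\<close> by (simp add: residual_def pca_init_def)
qed

lemma dominance_invariant_init:
  assumes "budget_feasible x"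
  shows "dominance_invariant x pca_init"
proof -
  have alloc: "alloc pca_init k = 0" for k
    by (simp add: alloc_def pca_init_def load_def)
  note remaining_ge = remaining_init_ge[OF assms]
  have "cyclic_clocks pca_init"
    by (auto simp: cyclic_clocks_def pca_init_def allN_def intro!: exI[of _ 0])
  moreover have "active_dominated x pca_init"
    using remaining_ge active_subset[of pca_init]
    by (simp add: active_dominated_def potential_def alloc)
  moreover have "level \<theta> = N" if "active pca_init \<subseteq> level \<theta>" for \<theta>
    using that vm_pos by (auto simp: active_def level_def pca_init_def)
  then have "level_dominated x pca_init"
    using remaining_ge by (simp add: level_dominated_def alloc)
  ultimately show ?thesis
    using consistent_init by (simp add: dominance_invariant_def)
qed

lemma dominance_invariant_run:
  assumes "budget_feasible x" "(pca_iter M eps v)\<^sup>*\<^sup>* pca_init s"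
  shows "dominance_invariant x s"
  using assms(2)
  by induction (use assms(1) dominance_invariant_init dominance_invariant_iter in blast)+

lemma final_remaining_le:
  assumes "pca_final M eps v s" "S \<subseteq> N"
  shows "remaining s S \<le> 0"
proof -
  have "dS s k = 0" if "k \<in> S" for k
    using assms that by (auto simp: pca_final_def)
  then have "rank (residual (wS s)) (dS s) S \<le> residual (wS s) {} + caps (dS s) (S - {})"
    using assms(2) by (intro rank_le) (auto simp: dual_solution_def covers_def)
  then show ?thesis
    using \<open>\<And>k. k \<in> S \<Longrightarrow> dS s k = 0\<close> by (simp add: remaining_def residual_def fN_empty)
qed

lemma final_level_dominates:
  assumes "budget_feasible x" "pca_final M eps v s"
  shows "sum x (level \<theta>) \<le> sum (alloc s) (level \<theta>)"
proof -
  have s: "cyclic_clocks s" "active_dominated x s" "level_dominated x s"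
    using dominance_invariant_run[OF assms(1)] assms(2)
    by (simp_all add: pca_final_def dominance_invariant_def)
  from level_active_dichotomy[OF s(1)] show ?thesis
  proof
    assume "active s \<subseteq> level \<theta>"
    then have "sum x (level \<theta>) \<le> sum (alloc s) (level \<theta>) + remaining s N"
      using s(3) by (simp add: level_dominated_def)
    then show ?thesis
      using final_remaining_le[OF assms(2) order_refl] by linarith
  next
    assume "level \<theta> \<subseteq> active s"
    then have "sum x (level \<theta>) \<le> sum (alloc s) (level \<theta>) + remaining s (level \<theta>)"
      using s(2) by (simp add: active_dominated_def potential_def)
    then show ?thesis
      using final_remaining_le[OF assms(2) level_subset, of \<theta>] by linarith
  qed
qed

theorem final_welfare_ge:
  assumes "budget_feasible x" "pca_final M eps v s"
  shows "(\<Sum>i\<in>N. v i * x i) \<le> (\<Sum>i\<in>N. v i * alloc s i)"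
  using final_level_dominates[OF assms] vm_pos
  by (intro sum_mult_mono_level_sets[OF finite_N]) (auto simp: level_def less_imp_le)

end

theorem theorem3p12:
  fixes M :: market and eps :: real and s :: pca_state
  assumes E0_sub: "E0 M \<subseteq> {1..nb M} \<times> {1..ms M}"
    and f_empty: "\<forall>j\<in>{1..ms M}. fs M j {} = 0"
    and f_nonneg: "\<forall>j\<in>{1..ms M}. \<forall>F. F \<subseteq> Esel (E0 M) j \<longrightarrow> 0 \<le> fs M j F"
    and f_mono: "\<forall>j\<in>{1..ms M}. \<forall>F G. F \<subseteq> G \<and> G \<subseteq> Esel (E0 M) j \<longrightarrow> fs M j F \<le> fs M j G"
    and f_submod: "\<forall>j\<in>{1..ms M}. \<forall>F G. F \<subseteq> Esel (E0 M) j \<and> G \<subseteq> Esel (E0 M) j \<longrightarrow>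
                     fs M j (F \<union> G) + fs M j (F \<inter> G) \<le> fs M j F + fs M j G"
    and v_pos: "\<forall>i\<in>{1..nb M}. 0 < val M i"
    and B_nonneg: "\<forall>i\<in>{1..nb M}. 0 \<le> bud M i"
    and rho_pos: "\<forall>j\<in>{1..ms M}. 0 < rho M j"
    and eps_pos: "0 < eps"
    and bids_grid: "\<forall>i\<in>allN M. \<exists>k::nat. 0 < k \<and> vm M i = real k * eps"
    and final: "pca_final M eps (vm M) s"
  shows "(\<Sum>i\<in>allN M. vm M i * sum (wS s) (Ebuy (Emod M) i)) \<ge> (\<Sum>i\<in>allN M. vm M i * xstar M i)
         \<and> ereal (\<Sum>i\<in>allN M. vm M i * xstar M i) = LW_OPT M"
proof -
  interpret auction_model M eps
    by unfold_locales (fact assms)+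
  have "(\<Sum>i\<in>N. v i * xstar M i) \<le> (\<Sum>i\<in>N. v i * sum (wS s) (Ebuy E i))"
    using final_welfare_ge[OF budget_feasible_xstar final] by (simp add: alloc_def sum_Ebuy)
  then show ?thesis
    using LW_OPT_xstar by simp
qed

end
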